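(* Consider, for every $m\in\mathbb{N}$, the model $y_m=A_mx_m^*+\varepsilon_m$ with $A_m\in\mathbb{R}^{m\times m}$ of full rank and $\varepsilon_m\sim\mathcal{N}(0,\sigma^2I_m)$, where $\sigma^2>0$ does not depend on $m$. Suppose that the singular values of $A_m$ satisfy $1=\gamma_{1,m}\ge\gamma_{2,m}\ge\dots\ge\gamma_{m,m}>0$ for all $m$ and $\gamma_{m,m}\to0$ as $m\to\infty$. Then for any sequence of vectors $(x_m^* )_{m\in\mathbb{N}}$, $x_m^*\in\mathbb{R}^m$, such that $\|x_m^*\|_2^2=O(m)$, we have, as $m\to\infty$, $$\sup_{\alpha\in[0,\infty)}\Bigl|\frac{1}{m\,\mathrm{cond}(A_m)^2}\bigl(\mathrm{SURE}_m(\alpha,y_m)-\mathrm{MSEE}_m(\alpha)\bigr)\Bigr|=O_{\mathbb{P}}\Bigl(\frac1{\sqrt m}\Bigr)$$ and $$\mathbb{E}\Biggl[\biggl(\sup_{\alpha\in[0,\infty)}\Bigl|\frac{1}{m\,\mathrm{cond}(A_m)^2}\bigl(\mathrm{SURE}_m(\alpha,y_m)-\mathrm{MSEE}_m(\alpha)\bigr)\Bigr|\biggr)^2\Biggr]=O\Bigl(\frac1m\Bigr).$$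
   Context: Tikhonov estimator: $\hat x_\alpha(y)=(A_m^{T}A_m+\alpha I)^{-1}A_m^{T}y$ for $\alpha\ge0$. The condition number is $\mathrm{cond}(A_m)=\gamma_{1,m}/\gamma_{m,m}=1/\gamma_{m,m}$. Mean squared estimation error: $\mathrm{MSEE}_m(\alpha)=\mathbb{E}\bigl[\|\Pi(x_m^*-\hat x_\alpha(y_m))\|_2^2\bigr]$, where $\Pi=A_m^+A_m$ is the orthogonal projector onto the range of $A_m^{T}$ (here the identity, as $A_m$ is invertible). Risk estimator: $$\mathrm{SURE}_m(\alpha,y)=\|A_m^{-1}y-\hat x_\alpha(y)\|_2^2-\sigma^2\,\mathrm{tr}\bigl((A_mA_m^{T})^{-1}\bigr)+2\sigma^2\,\mathrm{tr}\bigl((A_mA_m^{T})^{-1}A_m(A_m^{T}A_m+\alpha I)^{-1}A_m^{T}\bigr).$$ Equivalently, with a singular value decomposition $A_m=U\Sigma V^{T}$, $\Sigma=\mathrm{diag}(\gamma_{1,m},\dots,\gamma_{m,m})$, $u_i,v_i$ the columns of $U,V$, $y_i=\langle u_i,y\rangle$ and $x_{i,m}^*=\langle v_i,x_m^*\rangle$, $$\mathrm{SURE}_m(\alpha,y)=\sum_{i=1}^m\Bigl(\frac1{\gamma_{i,m}}-\frac{\gamma_{i,m}}{\gamma_{i,m}^2+\alpha}\Bigr)^2y_i^2-\sigma^2\sum_{i=1}^m\frac1{\gamma_{i,m}^2}+2\sigma^2\sum_{i=1}^m\frac1{\gamma_{i,m}^2+\alpha},$$ and $\mathrm{MSEE}_m(\alpha)$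 is obtained from this by replacing $y_i^2$ by $\gamma_{i,m}^2(x_{i,m}^* )^2+\sigma^2$. Stochastic order symbol: for random variables $Z_m$ and positive numbers $r_m$, $Z_m=O_{\mathbb{P}}(r_m)$ means $\lim_{T\to\infty}\limsup_{m\to\infty}\mathbb{P}(|Z_m|>Tr_m)=0$. *)

theory Defs
  imports
    "HOL-Probability.Probability"
    "Jordan_Normal_Form.Char_Poly"
    "Jordan_Normal_Form.Gauss_Jordan_Elimination"
    "Jordan_Normal_Form.DL_Rank"
begin

text \<open>
  As the dimension varies with the index of a sequence, matrices and vectors are the ones of
  \<^theory>\<open>Jordan_Normal_Form.Matrix\<close>, whose dimensions are values. Vector constants are used in
  prefix form because their infix syntax clashes with that of the type-indexed vectors.
\<close>

subsection \<open>Linear algebra\<close>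

definition sq_norm2 :: "real Matrix.vec \<Rightarrow> real" where
  "sq_norm2 v = scalar_prod v v"

definition mat_trace :: "real mat \<Rightarrow> real" where
  "mat_trace B = (\<Sum>i<dim_row B. B $$ (i, i))"

text \<open>Meaningful for invertible \<open>B\<close> only; unspecified otherwise.\<close>

definition mat_inv :: "real mat \<Rightarrow> real mat" where
  "mat_inv B = the (mat_inverse B)"

text \<open>Moore--Penrose inverse, as the unique solution of the four Penrose equations.\<close>

definition pseudo_inv :: "real mat \<Rightarrow> real mat" where
  "pseudo_inv A = (THE B. B \<in> carrier_mat (dim_col A) (dim_row A) \<and>
     A * B * A = A \<and> B * A * B = B \<and>
     transpose_mat (A * B) = A * B \<and> transpose_mat (B * A) = B * A)"

text \<open>
  The singular values of a square matrix in nonincreasing order: square roots of the eigenvalues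
  of \<open>A\<^sup>T A\<close>, repeated according to their multiplicity as roots of the characteristic polynomial.
  As \<open>A\<^sup>T A\<close> is symmetric and positive semidefinite, all these roots are real and nonnegative,
  so that the list has one entry per dimension. The index \<open>i\<close> in \<open>singular_value A i\<close> starts at 1.
\<close>

definition singular_values :: "real mat \<Rightarrow> real list" where
  "singular_values A =
     rev (sorted_list_of_multiset (image_mset sqrt (proots (char_poly (transpose_mat A * A)))))"

definition singular_value :: "real mat \<Rightarrow> nat \<Rightarrow> real" where
  "singular_value A i = singular_values A ! (i - 1)"

definition cond_number :: "real mat \<Rightarrow> real" where
  "cond_number A = singular_value A 1 / singular_value A (dim_row A)"

subsection \<open>Probability\<close>

text \<open>
  The law \<open>N(0, \<sigma>\<^sup>2 I\<^sub>n)\<close>: \<open>n\<close> independent \<open>N(0, \<sigma>\<^sup>2)\<close> coordinates. The second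
  parameter of \<^const>\<open>normal_density\<close> is the standard deviation.
\<close>

definition isotropic_gaussian :: "'w measure \<Rightarrow> nat \<Rightarrow> real \<Rightarrow> ('w \<Rightarrow> real Matrix.vec) \<Rightarrow> bool" where
  "isotropic_gaussian M n \<sigma> X \<longleftrightarrow>
     (\<forall>\<omega>\<in>space M. X \<omega> \<in> carrier_vec n) \<and>
     prob_space.indep_vars M (\<lambda>_. borel) (\<lambda>i \<omega>. vec_index (X \<omega>) i) {..<n} \<and>
     (\<forall>i<n. distributed M lborel (\<lambda>\<omega>. vec_index (X \<omega>) i) (\<lambda>t. ennreal (normal_density 0 \<sigma> t)))"

text \<open>
  \<open>Z\<^sub>m = O\<^sub>P(r\<^sub>m)\<close>. The random variables \<open>Z\<^sub>m\<close> may live on different probability spaces \<open>M m\<close>.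
\<close>

definition big_O_prob ::
    "(nat \<Rightarrow> 'w measure) \<Rightarrow> (nat \<Rightarrow> 'w \<Rightarrow> real) \<Rightarrow> (nat \<Rightarrow> real) \<Rightarrow> bool" where
  "big_O_prob M Z r \<longleftrightarrow>
     (\<forall>m. Z m \<in> borel_measurable (M m)) \<and>
     ((\<lambda>T. limsup (\<lambda>m. ereal (measure (M m) {\<omega> \<in> space (M m). \<bar>Z m \<omega>\<bar> > T * r m})))
        \<longlongrightarrow> 0) at_top"

subsection \<open>Tikhonov regularization\<close>

definition tikhonov_mat :: "real mat \<Rightarrow> real \<Rightarrow> real mat" where
  "tikhonov_mat A \<alpha> =
     mat_inv (transpose_mat A * A + \<alpha> \<cdot>\<^sub>m 1\<^sub>m (dim_col A)) * transpose_mat A"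

definition tikhonov :: "real mat \<Rightarrow> real \<Rightarrow> real Matrix.vec \<Rightarrow> real Matrix.vec" where
  "tikhonov A \<alpha> y = tikhonov_mat A \<alpha> *\<^sub>v y"

definition SURE :: "real mat \<Rightarrow> real \<Rightarrow> real \<Rightarrow> real Matrix.vec \<Rightarrow> real" where
  "SURE A \<sigma> \<alpha> y =
     sq_norm2 (mat_inv A *\<^sub>v y - tikhonov A \<alpha> y)
     - \<sigma>\<^sup>2 * mat_trace (mat_inv (A * transpose_mat A))
     + 2 * \<sigma>\<^sup>2 * mat_trace (mat_inv (A * transpose_mat A) * (A * tikhonov_mat A \<alpha>))"

definition MSEE ::
    "'w measure \<Rightarrow> real mat \<Rightarrow> real Matrix.vec \<Rightarrow> ('w \<Rightarrow> real Matrix.vec) \<Rightarrow> real \<Rightarrow> real" where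
  "MSEE M A x y \<alpha> =
     (\<integral>\<omega>. sq_norm2 ((pseudo_inv A * A) *\<^sub>v (x - tikhonov A \<alpha> (y \<omega>))) \<partial>M)"

definition scaled_error ::
    "'w measure \<Rightarrow> real mat \<Rightarrow> real \<Rightarrow> real Matrix.vec \<Rightarrow> ('w \<Rightarrow> real Matrix.vec)
      \<Rightarrow> 'w \<Rightarrow> real \<Rightarrow> real" where
  "scaled_error M A \<sigma> x y \<omega> \<alpha> =
     \<bar>1 / (real (dim_row A) * (cond_number A)\<^sup>2) * (SURE A \<sigma> \<alpha> (y \<omega>) - MSEE M A x y \<alpha>)\<bar>"

definition sup_error ::
    "'w measure \<Rightarrow> real mat \<Rightarrow> real \<Rightarrow> real Matrix.vec \<Rightarrow> ('w \<Rightarrow> real Matrix.vec)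
      \<Rightarrow> 'w \<Rightarrow> real" where
  "sup_error M A \<sigma> x y \<omega> = (SUP \<alpha>\<in>{0..}. scaled_error M A \<sigma> x y \<omega> \<alpha>)"

end

theory Submission
  imports Defs "Jordan_Normal_Form.Spectral_Radius"
begin

text \<open>
  Let \<open>A = U diag(g) V\<^sup>T\<close> be a singular value decomposition with smallest singular value
  \<open>\<gamma>\<close>, and put \<open>e = U\<^sup>T \<epsilon>\<close>, \<open>\<xi> = V\<^sup>T x\<close>. The scaled error is the modulus of
  \<open>F(\<alpha>) / m\<close> with \<open>F(\<alpha>) = \<Sum>\<^sub>i c\<^sub>i(\<alpha>) \<eta>\<^sub>i\<close>, where
  \<open>\<eta>\<^sub>i = 2 g\<^sub>i \<xi>\<^sub>i e\<^sub>i + e\<^sub>i\<^sup>2 - \<sigma>\<^sup>2\<close> are pairwise uncorrelated and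
  \<open>c\<^sub>i(\<alpha>) = (\<gamma> / g\<^sub>i)\<^sup>2 (\<alpha> / (g\<^sub>i\<^sup>2 + \<alpha>))\<^sup>2\<close>.

  No maximal inequality is needed. In the variable \<open>u = \<alpha> / (\<gamma>\<^sup>2 + \<alpha>) \<in> [0, 1)\<close> every
  \<open>c\<^sub>i\<close> vanishes at \<open>0\<close> and has a derivative between \<open>0\<close> and \<open>2 u\<close>, so Cauchy-Schwarz with the
  weight \<open>2 u\<close> bounds \<open>F(\<alpha>)\<^sup>2\<close>, simultaneously for all \<open>\<alpha>\<close>, by one quadratic form
  \<open>\<Sum>\<^sub>i\<^sub>j K\<^sub>i\<^sub>j \<eta>\<^sub>i \<eta>\<^sub>j\<close> with \<open>K\<^sub>i\<^sub>i \<le> 1\<close>. Its expectation is at most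
  \<open>\<Sum>\<^sub>i Var \<eta>\<^sub>i \<le> 4 \<sigma>\<^sup>2 \<parallel>x\<parallel>\<^sup>2 + 2 m \<sigma>\<^sup>4 = O(m)\<close>, and Chebyshev's inequality
  gives the stochastic bound.
\<close>

subsection \<open>Spectral theorem for real symmetric matrices\<close>

text \<open>A complex eigenvalue exists because the field is algebraically closed. Symmetry makes
  the Hermitian form of \<open>B\<close> real-valued, so this eigenvalue is real, hence a root of
  the real characteristic polynomial.\<close>

lemma symmetric_real_mat_has_eigenvalue:
  fixes B :: "real mat"
  assumes B: "B \<in> carrier_mat n n" and sym: "transpose_mat B = B" and n: "n > 0"
  shows "\<exists>e. eigenvalue B e"
proof -
  define C where "C = map_mat complex_of_real B"
  have C: "C \<in> carrier_mat n n" using B by (simp add: C_def)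
  obtain k where "k \<in> spectrum C" using spectrum_non_empty[OF C n] by blast
  then have k: "eigenvalue C k" by (simp add: spectrum_def)
  then obtain v where ev: "eigenvector C v k" by (auto simp: eigenvalue_def)
  then have v: "v \<in> carrier_vec n" "v \<noteq> 0\<^sub>v n" and Cv: "C *\<^sub>v v = k \<cdot>\<^sub>v v"
    using C by (auto simp: eigenvector_def)
  \<comment> \<open>\<open>S\<close> is the Hermitian form of \<open>C\<close> at \<open>v\<close>
    and \<open>N\<close> the squared norm of \<open>v\<close>. Comparing \<open>S = k * N\<close>
    with its conjugate gives \<open>cnj k = k\<close>, once \<open>N\<close> is known to be
    nonzero.\<close>
  define S where "S = (\<Sum>i<n. \<Sum>j<n. complex_of_real (B $$ (i,j)) * cnj (vec_index v i) * vec_index v j)"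
  define N where "N = (\<Sum>i<n. cnj (vec_index v i) * vec_index v i)"
  have Bsym: "B $$ (i,j) = B $$ (j,i)" if "i < n" "j < n" for i j
    using sym that B index_transpose_mat(1)[of j B i] by (metis carrier_matD)
  have row: "(\<Sum>j<n. complex_of_real (B $$ (i,j)) * vec_index v j) = k * vec_index v i" if "i < n" for i
  proof -
    have "vec_index (C *\<^sub>v v) i = (\<Sum>j<n. complex_of_real (B $$ (i,j)) * vec_index v j)"
      using that C v B by (auto simp: scalar_prod_def C_def lessThan_atLeast0 intro!: sum.cong)
    then show ?thesis using Cv that v by simp
  qed
  have "S = (\<Sum>i<n. cnj (vec_index v i) * (\<Sum>j<n. complex_of_real (B $$ (i,j)) * vec_index v j))"
    unfolding S_def by (simp add: sum_distrib_left mult_ac)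
  also have "\<dots> = k * N" using row by (simp add: N_def sum_distrib_left mult_ac)
  finally have S: "S = k * N" .
  have "cnj S = (\<Sum>i<n. \<Sum>j<n. complex_of_real (B $$ (i,j)) * vec_index v i * cnj (vec_index v j))"
    by (simp add: S_def)
  also have "\<dots> = (\<Sum>j<n. \<Sum>i<n. complex_of_real (B $$ (i,j)) * vec_index v i * cnj (vec_index v j))"
    by (rule sum.swap)
  also have "\<dots> = S" unfolding S_def by (intro sum.cong) (auto simp: Bsym)
  finally have "cnj S = S" .
  moreover have "cnj N = N" by (simp add: N_def mult.commute)
  ultimately have eq: "cnj k * N = k * N" using S by (metis complex_cnj_mult)
  have N2: "N = complex_of_real (\<Sum>i<n. (cmod (vec_index v i))\<^sup>2)"
    unfolding N_def of_real_sum by (intro sum.cong refl) (metis complex_norm_square mult.commute)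
  obtain i where i: "i < n" "vec_index v i \<noteq> 0" using v by (metis eq_vecI carrier_vecD index_zero_vec)
  have "(\<Sum>i<n. (cmod (vec_index v i))\<^sup>2) > 0"
    using i by (intro sum_pos2[of _ i]) auto
  then have "N \<noteq> 0" using N2 by (metis of_real_eq_0_iff less_irrefl)
  with eq have "cnj k = k" by simp
  then obtain r where r: "k = complex_of_real r" by (metis Reals_cnj_iff Reals_cases)
  \<comment> \<open>The eigenvector \<open>v\<close> may be genuinely complex; a real one comes from
    the root \<open>r\<close> of \<open>char_poly B\<close>.\<close>
  have "poly (char_poly C) k = 0" using eigenvalue_root_char_poly[OF C] k by simp
  moreover have "char_poly C = map_poly complex_of_real (char_poly B)"
    unfolding C_def by (rule of_real_hom.char_poly_hom[OF B])
  ultimately have "complex_of_real (poly (char_poly B) r) = 0"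
    unfolding r by (simp add: of_real_hom.poly_map_poly)
  then have "poly (char_poly B) r = 0" by simp
  then show ?thesis using eigenvalue_root_char_poly[OF B] by blast
qed

text \<open>The Householder reflection along w = v - e_0 exchanges the unit vectors e_0 and v. If
  they coincide, no such direction exists and the identity serves.\<close>

lemma householder_unit_vec:
  fixes v :: "real Matrix.vec"
  assumes v: "v \<in> carrier_vec n" and nv: "scalar_prod v v = 1" and n: "n > 0"
  shows "\<exists>W\<in>carrier_mat n n. transpose_mat W = W \<and> W * W = 1\<^sub>m n \<and> W *\<^sub>v unit_vec n 0 = v"
proof (cases "v = unit_vec n 0")
  case True
  then show ?thesis by (intro bexI[of _ "1\<^sub>m n"]) auto
next
  case False
  define \<delta> where "\<delta> i = (if i = 0 then 1 else 0::real)" for i :: nat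
  define w where "w i = vec_index v i - \<delta> i" for i
  define q where "q = (\<Sum>i<n. w i * w i)"
  define W where "W = Matrix.mat n n (\<lambda>(i,j). (if i = j then 1 else 0) - 2 / q * w i * w j)"
  have W: "W \<in> carrier_mat n n" by (simp add: W_def)
  have sv: "(\<Sum>i<n. vec_index v i * vec_index v i) = 1"
    using nv v by (simp add: scalar_prod_def lessThan_atLeast0)
  have "q = (\<Sum>i<n. vec_index v i * vec_index v i) - 2 * (\<Sum>i<n. \<delta> i * vec_index v i) + (\<Sum>i<n. \<delta> i)"
    unfolding q_def w_def sum_distrib_left sum_subtractf[symmetric] sum.distrib[symmetric]
    by (intro sum.cong) (auto simp: \<delta>_def algebra_simps)
  also have "(\<Sum>i<n. \<delta> i * vec_index v i) = vec_index v 0"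
    using n by (simp add: \<delta>_def if_distrib[of "\<lambda>t. t * _"] cong: if_cong)
  also have "(\<Sum>i<n. \<delta> i) = 1" using n by (simp add: \<delta>_def)
  \<comment> \<open>As v is a unit vector, |v - e_0|^2 = 2 - 2 v_0. This value of \<open>q\<close>
    turns the first column of \<open>W\<close> into e_0 + w = v.\<close>
  finally have q: "q = - 2 * w 0" using sv by (simp add: w_def \<delta>_def)
  obtain i where i: "i < n" "w i \<noteq> 0"
  proof -
    have "\<exists>i<n. vec_index v i \<noteq> vec_index (unit_vec n 0) i" using False v 
      by (metis eq_vecI carrier_vecD index_unit_vec(3))
    then show ?thesis using that n by (auto simp: w_def \<delta>_def split: if_splits)
  qed
  then have "q > 0" unfolding q_def
    by (intro sum_pos2[of _ i]) (auto simp: zero_less_mult_iff linorder_neq_iff)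
  have tW: "transpose_mat W = W" by (rule eq_matI) (auto simp: W_def)
  have "W * W = 1\<^sub>m n"
  proof (rule eq_matI)
    fix i j assume "i < dim_row (1\<^sub>m n)" "j < dim_col (1\<^sub>m n)"
    then have ij: "i < n" "j < n" by auto
    have "(W * W) $$ (i,j) = (\<Sum>k<n. W $$ (i,k) * W $$ (k,j))"
      using ij W by (simp add: scalar_prod_def lessThan_atLeast0)
    also have "\<dots> = (\<Sum>k<n. (if i = k then if k = j then 1 else 0 else 0)
        - (if k = j then 2 / q * w i * w k else 0) - (if i = k then 2 / q * w k * w j else 0)
        + 4 / q\<^sup>2 * w i * w j * (w k * w k))"
      using ij by (intro sum.cong) (auto simp: W_def algebra_simps power2_eq_square)
    also have "\<dots> = (if i = j then 1 else 0) - 4 / q * w i * w j + 4 / q\<^sup>2 * w i * w j * q"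
    proof -
      have "(\<Sum>k<n. 4 / q\<^sup>2 * w i * w j * (w k * w k)) = 4 / q\<^sup>2 * w i * w j * q"
        unfolding q_def by (rule sum_distrib_left[symmetric])
      then show ?thesis using ij by (simp add: sum.distrib sum_subtractf cong: if_cong)
    qed
    also have "\<dots> = 1\<^sub>m n $$ (i,j)" using \<open>q > 0\<close> ij by (simp add: power2_eq_square)
    finally show "(W * W) $$ (i,j) = 1\<^sub>m n $$ (i,j)" .
  qed (use W in auto)
  moreover have "W *\<^sub>v unit_vec n 0 = v"
  proof (rule eq_vecI)
    fix i assume "i < dim_vec v"
    then have i: "i < n" using v by simp
    have "vec_index (W *\<^sub>v unit_vec n 0) i = W $$ (i,0)" using i n W by simp
    also have "\<dots> = vec_index v i"
      using i n \<open>q > 0\<close> by (simp add: W_def q) (auto simp: w_def \<delta>_def field_simps)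
    finally show "vec_index (W *\<^sub>v unit_vec n 0) i = vec_index v i" .
  qed (use W v in auto)
  ultimately show ?thesis using W tW by blast
qed

lemma block_diag_mult:
  fixes A1 :: "'a :: semiring_1 mat"
  assumes "A1 \<in> carrier_mat k k" "D1 \<in> carrier_mat n n" "A2 \<in> carrier_mat k k" "D2 \<in> carrier_mat n n"
  shows "four_block_mat A1 (0\<^sub>m k n) (0\<^sub>m n k) D1 * four_block_mat A2 (0\<^sub>m k n) (0\<^sub>m n k) D2
    = four_block_mat (A1 * A2) (0\<^sub>m k n) (0\<^sub>m n k) (D1 * D2)"
  using assms by (subst mult_four_block_mat[of _ k k _ n _ n _ _ k _ n]) auto

text \<open>Deflation. A reflection \<open>W\<close> takes e_0 to a unit eigenvector, so the
  symmetric matrix \<open>W * B * W\<close> splits into the eigenvalue and a smaller symmetric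
  block, to which the induction hypothesis applies.\<close>

lemma real_spectral_theorem:
  fixes B :: "real mat"
  assumes "B \<in> carrier_mat n n" "transpose_mat B = B"
  shows "\<exists>V\<in>carrier_mat n n. \<exists>l. transpose_mat V * V = 1\<^sub>m n \<and> transpose_mat V * B * V = mat_diag n l"
  using assms
proof (induction n arbitrary: B)
  case 0
  then show ?case by (intro bexI[of _ "1\<^sub>m 0"] exI[of _ "\<lambda>_. 0"]) (auto simp: mat_diag_def)
next
  case (Suc n)
  note B = Suc.prems(1) and sym = Suc.prems(2)
  obtain e where "eigenvalue B e" using symmetric_real_mat_has_eigenvalue[OF B sym] by auto
  then obtain x where x: "x \<in> carrier_vec (Suc n)" "x \<noteq> 0\<^sub>v (Suc n)" "B *\<^sub>v x = e \<cdot>\<^sub>v x"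
    using B by (auto simp: eigenvalue_def eigenvector_def)
  define v where "v = (1 / sqrt (scalar_prod x x)) \<cdot>\<^sub>v x"
  have xx: "scalar_prod x x > 0"
  proof -
    obtain i where i: "i < Suc n" "vec_index x i \<noteq> 0" using x by (metis eq_vecI carrier_vecD index_zero_vec)
    then have "(\<Sum>i<Suc n. vec_index x i * vec_index x i) > 0"
      by (intro sum_pos2[of _ i]) (auto simp: zero_less_mult_iff linorder_neq_iff)
    then show ?thesis using x(1) by (simp add: scalar_prod_def lessThan_atLeast0 del: sum.op_ivl_Suc sum.lessThan_Suc)
  qed
  have v: "v \<in> carrier_vec (Suc n)" using x by (simp add: v_def)
  have "scalar_prod v v = 1" using x xx by (simp add: v_def)
  then obtain W where W: "W \<in> carrier_mat (Suc n) (Suc n)" "transpose_mat W = W"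
      "W * W = 1\<^sub>m (Suc n)" "W *\<^sub>v unit_vec (Suc n) 0 = v"
    using householder_unit_vec[OF v] by auto
  have Bv: "B *\<^sub>v v = e \<cdot>\<^sub>v v" using x B
    by (simp add: v_def mult_mat_vec smult_smult_assoc mult.commute)
  define D where "D = W * B * W"
  have D: "D \<in> carrier_mat (Suc n) (Suc n)" using W B by (simp add: D_def)
  have symD: "transpose_mat D = D"
    using W B sym by (simp add: D_def transpose_mult[of _ "Suc n" "Suc n" _ "Suc n"] assoc_mult_mat[of _ "Suc n" "Suc n" _ "Suc n" _ "Suc n"])
  have "D *\<^sub>v unit_vec (Suc n) 0 = W *\<^sub>v (B *\<^sub>v (W *\<^sub>v unit_vec (Suc n) 0))"
    using W B by (simp add: D_def assoc_mult_mat_vec[of _ "Suc n" "Suc n" _ "Suc n"])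
  also have "\<dots> = e \<cdot>\<^sub>v (W *\<^sub>v (W *\<^sub>v unit_vec (Suc n) 0))"
    using W Bv v by (simp add: mult_mat_vec)
  also have "\<dots> = e \<cdot>\<^sub>v unit_vec (Suc n) 0"
    using W(1,3) by (simp flip: assoc_mult_mat_vec[of W "Suc n" "Suc n" W "Suc n"])
  finally have col: "D *\<^sub>v unit_vec (Suc n) 0 = e \<cdot>\<^sub>v unit_vec (Suc n) 0" .
  have D0: "D $$ (i,0) = (if i = 0 then e else 0)" if "i < Suc n" for i
  proof -
    have "D $$ (i,0) = vec_index (D *\<^sub>v unit_vec (Suc n) 0) i" using that D by simp
    then show ?thesis using that by (simp add: col)
  qed
  \<comment> \<open>By symmetry the first row vanishes off the diagonal along with the first column,
    which gives the block form \<open>DC\<close>.\<close>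
  have D0': "D $$ (0,i) = (if i = 0 then e else 0)" if "i < Suc n" for i
    using D0[OF that] symD D that by (metis carrier_matD index_transpose_mat(1) zero_less_Suc)
  define C where "C = Matrix.mat n n (\<lambda>(i,j). D $$ (Suc i, Suc j))"
  define E where "E = mat_diag 1 (\<lambda>_. e)"
  have C: "C \<in> carrier_mat n n" by (simp add: C_def)
  have E: "E \<in> carrier_mat 1 1" by (simp add: E_def)
  have DC: "D = four_block_mat E (0\<^sub>m 1 n) (0\<^sub>m n 1) C"
    by (rule eq_matI) (use D C E D0 D0' in \<open>auto simp: E_def C_def mat_diag_def\<close>)
  have "transpose_mat C = C" 
  proof (rule eq_matI)
    fix i j assume "i < dim_row C" "j < dim_col C"
    then have "i < n" "j < n" by (auto simp: C_def)
    then show "transpose_mat C $$ (i,j) = C $$ (i,j)"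
      using arg_cong[OF symD, of "\<lambda>X. X $$ (Suc i, Suc j)"] D by (simp add: C_def)
  qed (auto simp: C_def)
  then obtain V' l' where V': "V' \<in> carrier_mat n n" "transpose_mat V' * V' = 1\<^sub>m n"
      "transpose_mat V' * C * V' = mat_diag n l'"
    using Suc.IH[OF C] by blast
  \<comment> \<open>\<open>F\<close> extends the matrix diagonalising \<open>C\<close> by a unit
    block; \<open>W * F\<close> will diagonalise \<open>B\<close>.\<close>
  define F where "F = four_block_mat (1\<^sub>m 1) (0\<^sub>m 1 n) (0\<^sub>m n 1) V'"
  have F: "F \<in> carrier_mat (Suc n) (Suc n)"
    using four_block_carrier_mat[of "1\<^sub>m 1 :: real mat" 1 1 V' n n] V' by (simp add: F_def)
  have tF: "transpose_mat F = four_block_mat (1\<^sub>m 1) (0\<^sub>m 1 n) (0\<^sub>m n 1) (transpose_mat V')"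
    using V' by (simp add: F_def transpose_four_block_mat[of _ 1 1 _ n _ n])
  have FF: "transpose_mat F * F = 1\<^sub>m (Suc n)"
    unfolding tF unfolding F_def
    using block_diag_mult[of "1\<^sub>m 1" 1 "transpose_mat V'" n "1\<^sub>m 1" V'] V'
    by (auto intro!: eq_matI)
  have "transpose_mat F * D * F = four_block_mat E (0\<^sub>m 1 n) (0\<^sub>m n 1) (transpose_mat V' * C * V')"
    unfolding tF DC unfolding F_def
    using block_diag_mult[of "1\<^sub>m 1" 1 "transpose_mat V'" n E C]
      block_diag_mult[of E 1 "transpose_mat V' * C" n "1\<^sub>m 1" V'] V' E C by simp
  also have "\<dots> = mat_diag (Suc n) (\<lambda>i. if i = 0 then e else l' (i - 1))"
    unfolding V' by (rule eq_matI) (auto simp: E_def mat_diag_def)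
  finally have FDF: "transpose_mat F * D * F = mat_diag (Suc n) (\<lambda>i. if i = 0 then e else l' (i - 1))" .
  note assoc = assoc_mult_mat[of _ "Suc n" "Suc n" _ "Suc n" _ "Suc n"]
  have tWF: "transpose_mat (W * F) = transpose_mat F * W"
    using W F by (simp add: transpose_mult[of _ "Suc n" "Suc n" _ "Suc n"])
  have "transpose_mat (W * F) * (W * F) = transpose_mat F * ((W * W) * F)"
    unfolding tWF using W(1) F by (simp add: assoc)
  also have "\<dots> = 1\<^sub>m (Suc n)" using W(3) F FF by simp
  finally have 1: "transpose_mat (W * F) * (W * F) = 1\<^sub>m (Suc n)" .
  have 2: "transpose_mat (W * F) * B * (W * F) = transpose_mat F * D * F"
    unfolding tWF D_def using W(1) F B by (simp add: assoc)
  show ?case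
    by (intro bexI[of _ "W * F"] exI conjI 1) (use 2 FDF W F in auto)
qed

subsection \<open>Spectral form of the estimators\<close>

definition orthogonal_real :: "nat \<Rightarrow> real mat \<Rightarrow> bool" where
  "orthogonal_real n X \<longleftrightarrow> X \<in> carrier_mat n n \<and> transpose_mat X * X = 1\<^sub>m n"

text \<open>A singular value decomposition when \<open>X\<close> and \<open>Y\<close> are orthogonal
  and \<open>f\<close> is nonnegative. For orthogonal factors this family is closed under
  transposes, compatible products, inverses and, for \<open>X = Y\<close>, shifts by multiples of
  the identity. All matrices in the estimators lie in it, so matrix identities become scalar ones in
  \<open>f\<close>.\<close>

definition sandwich :: "nat \<Rightarrow> real mat \<Rightarrow> (nat \<Rightarrow> real) \<Rightarrow> real mat \<Rightarrow> real mat" where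
  "sandwich n X f Y = X * mat_diag n f * transpose_mat Y"

lemma orthogonal_realD:
  assumes "orthogonal_real n X"
  shows "X \<in> carrier_mat n n" "transpose_mat X \<in> carrier_mat n n"
    "transpose_mat X * X = 1\<^sub>m n" "X * transpose_mat X = 1\<^sub>m n"
  using assms mat_mult_left_right_inverse[of "transpose_mat X" n X]
  by (auto simp: orthogonal_real_def)

lemma sandwich_carrier [simp]:
  assumes "X \<in> carrier_mat n n" "Y \<in> carrier_mat n n"
  shows "sandwich n X f Y \<in> carrier_mat n n"
  using assms by (auto simp: sandwich_def intro!: mult_carrier_mat)

lemma sandwich_dim [simp]:
  "dim_row (sandwich n X f Y) = dim_row X" "dim_col (sandwich n X f Y) = dim_row Y"
  by (simp_all add: sandwich_def)

lemma sandwich_index: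
  assumes "X \<in> carrier_mat n n" "Y \<in> carrier_mat n n" "i < n" "j < n"
  shows "sandwich n X f Y $$ (i,j) = (\<Sum>k<n. X $$ (i,k) * f k * Y $$ (j,k))"
  using assms unfolding sandwich_def
  by (subst mat_diag_mult_right[of X n n]) (auto simp: scalar_prod_def lessThan_atLeast0 intro!: sum.cong)

lemma sandwich_cong:
  assumes "\<And>i. i < n \<Longrightarrow> f i = h i"
  shows "sandwich n X f Y = sandwich n X h Y"
proof -
  have "mat_diag n f = mat_diag n h" by (rule eq_matI) (auto simp: mat_diag_def assms)
  then show ?thesis by (simp add: sandwich_def)
qed

lemma sandwich_transpose:
  assumes "X \<in> carrier_mat n n" "Y \<in> carrier_mat n n"
  shows "transpose_mat (sandwich n X f Y) = sandwich n Y f X"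
proof (rule eq_matI)
  fix i j assume "i < dim_row (sandwich n Y f X)" "j < dim_col (sandwich n Y f X)"
  then have "i < n" "j < n" using assms by auto
  then show "transpose_mat (sandwich n X f Y) $$ (i,j) = sandwich n Y f X $$ (i,j)"
    using assms by (simp add: sandwich_index mult_ac)
qed (use assms in auto)

text \<open>The inner factor Y^T Y cancels and the diagonal matrices multiply entrywise.\<close>

lemma sandwich_mult:
  assumes "X \<in> carrier_mat n n" "orthogonal_real n Y" "Z \<in> carrier_mat n n"
  shows "sandwich n X f Y * sandwich n Y h Z = sandwich n X (\<lambda>i. f i * h i) Z"
proof -
  note Y = orthogonal_realD[OF assms(2)]
  note assoc = assoc_mult_mat[of _ n n _ n _ n] mult_carrier_mat[of _ n n _ n]
  have "sandwich n X f Y * sandwich n Y h Z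
      = X * (mat_diag n f * ((transpose_mat Y * Y) * (mat_diag n h * transpose_mat Z)))"
    unfolding sandwich_def using assms Y(1,2) by (simp add: assoc)
  also have "\<dots> = X * ((mat_diag n f * mat_diag n h) * transpose_mat Z)"
    using assms Y by (simp add: assoc left_mult_one_mat[of _ n n] del: mat_diag_diag)
  also have "\<dots> = sandwich n X (\<lambda>i. f i * h i) Z"
    unfolding sandwich_def using assms by (simp add: assoc)
  finally show ?thesis .
qed

lemma sandwich_one:
  assumes "orthogonal_real n X"
  shows "sandwich n X (\<lambda>_. 1) X = 1\<^sub>m n"
  using orthogonal_realD[OF assms] by (simp add: sandwich_def)

lemma sandwich_add_smult_one:
  assumes "orthogonal_real n X"
  shows "sandwich n X f X + a \<cdot>\<^sub>m 1\<^sub>m n = sandwich n X (\<lambda>i. f i + a) X"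
proof (rule eq_matI)
  note X = orthogonal_realD[OF assms]
  fix i j assume "i < dim_row (sandwich n X (\<lambda>i. f i + a) X)" "j < dim_col (sandwich n X (\<lambda>i. f i + a) X)"
  then have ij: "i < n" "j < n" using X by auto
  have "1\<^sub>m n $$ (i,j) = (\<Sum>k<n. X $$ (i,k) * 1 * X $$ (j,k))"
    unfolding sandwich_one[OF assms, symmetric] using X ij by (simp add: sandwich_index)
  then show "(sandwich n X f X + a \<cdot>\<^sub>m 1\<^sub>m n) $$ (i,j) = sandwich n X (\<lambda>i. f i + a) X $$ (i,j)"
    using X ij by (simp add: sandwich_index algebra_simps sum.distrib sum_distrib_left)
qed (use orthogonal_realD(1)[OF assms] in auto)

text \<open>Exchanging the sums leaves the squared norm of each column of \<open>X\<close>, which is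
  1.\<close>

lemma sandwich_trace:
  assumes "orthogonal_real n X"
  shows "mat_trace (sandwich n X f X) = (\<Sum>i<n. f i)"
proof -
  note X = orthogonal_realD[OF assms]
  have col: "(\<Sum>i<n. X $$ (i,k) * X $$ (i,k)) = 1" if "k < n" for k
    using arg_cong[OF X(3), of "\<lambda>M. M $$ (k,k)"] X(1) that
    by (simp add: scalar_prod_def lessThan_atLeast0)
  have "mat_trace (sandwich n X f X) = (\<Sum>i<n. \<Sum>k<n. X $$ (i,k) * f k * X $$ (i,k))"
    using X by (auto simp: mat_trace_def sandwich_index)
  also have "\<dots> = (\<Sum>k<n. f k * (\<Sum>i<n. X $$ (i,k) * X $$ (i,k)))"
    by (subst sum.swap) (simp add: sum_distrib_left mult_ac)
  finally show ?thesis using col by simp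
qed

lemma sandwich_mult_vec:
  assumes "X \<in> carrier_mat n n" "Y \<in> carrier_mat n n" "v \<in> carrier_vec n"
  shows "sandwich n X f Y *\<^sub>v v = X *\<^sub>v Matrix.vec n (\<lambda>i. f i * vec_index (transpose_mat Y *\<^sub>v v) i)"
proof -
  have "mat_diag n f *\<^sub>v w = Matrix.vec n (\<lambda>i. f i * vec_index w i)" if w: "w \<in> carrier_vec n" for w :: "real Matrix.vec"
    by (rule eq_vecI) (use w in \<open>auto simp: mat_diag_def scalar_prod_def if_distrib[of "\<lambda>t. t * _"] cong: if_cong\<close>)
  moreover have "transpose_mat Y *\<^sub>v v \<in> carrier_vec n" using assms by auto
  ultimately show ?thesis unfolding sandwich_def using assms
    by (simp add: assoc_mult_mat_vec[of _ n n _ n])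
qed

section \<open>Euclidean norm, inverse and pseudoinverse\<close>

lemma sq_norm2_sum: "v \<in> carrier_vec n \<Longrightarrow> sq_norm2 v = (\<Sum>i<n. (vec_index v i)\<^sup>2)"
  by (auto simp: sq_norm2_def scalar_prod_def power2_eq_square lessThan_atLeast0)

lemma sq_norm2_orthogonal:
  assumes "orthogonal_real n X" "v \<in> carrier_vec n"
  shows "sq_norm2 (X *\<^sub>v v) = sq_norm2 v"
proof -
  note X = orthogonal_realD[OF assms(1)]
  have "scalar_prod (X *\<^sub>v v) (X *\<^sub>v v) = scalar_prod (transpose_mat X *\<^sub>v (X *\<^sub>v v)) v"
    by (rule transpose_vec_mult_scalar[symmetric, of X n n]) (use X assms in auto)
  also have "transpose_mat X *\<^sub>v (X *\<^sub>v v) = v"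
    using X assms by (simp add: assoc_mult_mat_vec[of _ n n _ n, symmetric])
  finally show ?thesis by (simp add: sq_norm2_def)
qed

text \<open>\<open>mat_inverse\<close> returns an option, so \<open>B\<close> must first be seen to
  be a unit of the matrix ring; uniqueness of inverses then identifies the result with
  \<open>C\<close>.\<close>

lemma mat_inv_eqI:
  assumes B: "B \<in> carrier_mat n n" and C: "C \<in> carrier_mat n n" and BC: "B * C = 1\<^sub>m n"
  shows "mat_inv B = C"
proof -
  have CB: "C * B = 1\<^sub>m n" by (rule mat_mult_left_right_inverse[OF B C BC])
  have "B \<in> Units (ring_mat TYPE(real) n ())"
    unfolding Units_def using B C BC CB by (auto simp: ring_mat_simps)
  then obtain D where D: "mat_inverse B = Some D" using mat_inverse(1)[OF B, of "()"] by (cases "mat_inverse B") auto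
  then have "B * D = 1\<^sub>m n" "D \<in> carrier_mat n n" using mat_inverse(2)[OF B D] by auto
  then have "D = C" using B C CB assoc_mult_mat[of C n n B n D n] by simp
  then show ?thesis using D by (simp add: mat_inv_def)
qed

lemma mat_inv_sandwich:
  assumes X: "orthogonal_real n X" and Y: "orthogonal_real n Y" and f: "\<And>i. i < n \<Longrightarrow> f i \<noteq> 0"
  shows "mat_inv (sandwich n X f Y) = sandwich n Y (\<lambda>i. 1 / f i) X"
proof (rule mat_inv_eqI)
  have "sandwich n X f Y * sandwich n Y (\<lambda>i. 1 / f i) X = sandwich n X (\<lambda>i. f i * (1 / f i)) X"
    using orthogonal_realD(1)[OF X] Y by (rule sandwich_mult) (rule orthogonal_realD(1)[OF X])
  also have "\<dots> = sandwich n X (\<lambda>i. 1) X" using f by (intro sandwich_cong) auto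
  finally show "sandwich n X f Y * sandwich n Y (\<lambda>i. 1 / f i) X = 1\<^sub>m n" by (simp add: sandwich_one[OF X])
qed (use orthogonal_realD(1)[OF X] orthogonal_realD(1)[OF Y] in auto)

text \<open>Multiplying the Penrose equation \<open>A * B * A = A\<close> by the inverse
  \<open>C\<close> from both sides forces \<open>B = C\<close>.\<close>

lemma pseudo_inv_eq_mat_inv:
  assumes A: "A \<in> carrier_mat n n" and C: "C \<in> carrier_mat n n" and AC: "A * C = 1\<^sub>m n"
  shows "pseudo_inv A = C"
proof -
  have CA: "C * A = 1\<^sub>m n" by (rule mat_mult_left_right_inverse[OF A C AC])
  note assoc = assoc_mult_mat[of _ n n _ n _ n] mult_carrier_mat[of _ n n _ n]
  show ?thesis unfolding pseudo_inv_def
  proof (rule the_equality)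
    fix B assume B: "B \<in> carrier_mat (dim_col A) (dim_row A) \<and>
     A * B * A = A \<and> B * A * B = B \<and> transpose_mat (A * B) = A * B \<and> transpose_mat (B * A) = B * A"
    then have Bc: "B \<in> carrier_mat n n" and eq: "A * B * A = A" using A by auto
    have "C * (A * B * A) * C = (C * A) * B * (A * C)" using A Bc C by (simp add: assoc)
    then show "B = C" unfolding eq using A Bc C AC CA by simp
  qed (use A C AC CA in auto)
qed

section \<open>Estimators and their errors in singular coordinates\<close>

locale real_svd =
  fixes n :: nat and A U V :: "real mat" and g :: "nat \<Rightarrow> real"
  assumes U: "orthogonal_real n U" and V: "orthogonal_real n V"
    and A_eq: "A = sandwich n U g V" and g_pos: "\<And>i. i < n \<Longrightarrow> g i > 0"
begin

lemmas U_carrier = orthogonal_realD(1)[OF U]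
lemmas V_carrier = orthogonal_realD(1)[OF V]

lemma A_carrier: "A \<in> carrier_mat n n"
  using U_carrier V_carrier by (simp add: A_eq)

lemma mat_inv_A: "mat_inv A = sandwich n V (\<lambda>i. 1 / g i) U"
  unfolding A_eq by (intro mat_inv_sandwich U V) (metis g_pos less_irrefl)

lemma mat_inv_gram: "mat_inv (A * transpose_mat A) = sandwich n U (\<lambda>i. 1 / (g i)\<^sup>2) U"
proof -
  have "A * transpose_mat A = sandwich n U (\<lambda>i. (g i)\<^sup>2) U"
    unfolding A_eq sandwich_transpose[OF U_carrier V_carrier]
      sandwich_mult[OF U_carrier V U_carrier] by (simp add: power2_eq_square)
  then show ?thesis by (simp add: mat_inv_sandwich[OF U U] g_pos[THEN less_imp_neq, symmetric])
qed

lemma tikhonov_mat_eq: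
  assumes "\<alpha> \<ge> 0"
  shows "tikhonov_mat A \<alpha> = sandwich n V (\<lambda>i. g i / ((g i)\<^sup>2 + \<alpha>)) U"
proof -
  have "(g i)\<^sup>2 + \<alpha> \<noteq> 0" if "i < n" for i using g_pos[OF that] assms
    by (metis add_pos_nonneg less_irrefl zero_less_power)
  moreover have "transpose_mat A * A + \<alpha> \<cdot>\<^sub>m 1\<^sub>m (dim_col A) = sandwich n V (\<lambda>i. (g i)\<^sup>2 + \<alpha>) V"
    using A_carrier V_carrier unfolding A_eq sandwich_transpose[OF U_carrier V_carrier] sandwich_mult[OF V_carrier U V_carrier]
    by (simp add: power2_eq_square sandwich_add_smult_one[OF V])
  ultimately have "tikhonov_mat A \<alpha> = sandwich n V (\<lambda>i. 1 / ((g i)\<^sup>2 + \<alpha>)) V * transpose_mat A"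
    by (simp add: tikhonov_mat_def mat_inv_sandwich[OF V V])
  also have "\<dots> = sandwich n V (\<lambda>i. g i / ((g i)\<^sup>2 + \<alpha>)) U"
    unfolding A_eq sandwich_transpose[OF U_carrier V_carrier] sandwich_mult[OF V_carrier V U_carrier] by simp
  finally show ?thesis .
qed

lemma SURE_spectral:
  assumes "\<alpha> \<ge> 0" and y: "y \<in> carrier_vec n"
  shows "SURE A \<sigma> \<alpha> y =
    (\<Sum>i<n. (1 / g i - g i / ((g i)\<^sup>2 + \<alpha>))\<^sup>2 * (vec_index (transpose_mat U *\<^sub>v y) i)\<^sup>2)
    - \<sigma>\<^sup>2 * (\<Sum>i<n. 1 / (g i)\<^sup>2) + 2 * \<sigma>\<^sup>2 * (\<Sum>i<n. 1 / ((g i)\<^sup>2 + \<alpha>))"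
proof -
  let ?z = "transpose_mat U *\<^sub>v y"
  have "mat_inv A *\<^sub>v y - tikhonov A \<alpha> y
      = V *\<^sub>v Matrix.vec n (\<lambda>i. 1 / g i * vec_index ?z i) - V *\<^sub>v Matrix.vec n (\<lambda>i. g i / ((g i)\<^sup>2 + \<alpha>) * vec_index ?z i)"
    unfolding tikhonov_def mat_inv_A tikhonov_mat_eq[OF assms(1)] sandwich_mult_vec[OF V_carrier U_carrier y] ..
  \<comment> \<open>\<open>V\<close> factors out of the residual and drops out of its norm.\<close>
  also have "\<dots> = V *\<^sub>v (Matrix.vec n (\<lambda>i. 1 / g i * vec_index ?z i) - Matrix.vec n (\<lambda>i. g i / ((g i)\<^sup>2 + \<alpha>) * vec_index ?z i))"
    using V_carrier by (intro mult_minus_distrib_mat_vec[symmetric]) auto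
  finally have "sq_norm2 (mat_inv A *\<^sub>v y - tikhonov A \<alpha> y) =
     sq_norm2 (Matrix.vec n (\<lambda>i. 1 / g i * vec_index ?z i) - Matrix.vec n (\<lambda>i. g i / ((g i)\<^sup>2 + \<alpha>) * vec_index ?z i))"
    using sq_norm2_orthogonal[OF V] by simp
  also have "\<dots> = (\<Sum>i<n. (1 / g i - g i / ((g i)\<^sup>2 + \<alpha>))\<^sup>2 * (vec_index ?z i)\<^sup>2)"
    by (subst sq_norm2_sum[of _ n]) (auto simp: power_mult_distrib[symmetric] algebra_simps)
  finally have 1: "sq_norm2 (mat_inv A *\<^sub>v y - tikhonov A \<alpha> y) = \<dots>" .
  have 2: "mat_trace (mat_inv (A * transpose_mat A)) = (\<Sum>i<n. 1 / (g i)\<^sup>2)"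
    by (simp add: mat_inv_gram sandwich_trace[OF U])
  have "mat_inv (A * transpose_mat A) * (A * tikhonov_mat A \<alpha>)
     = sandwich n U (\<lambda>i. 1 / (g i)\<^sup>2 * (g i * (g i / ((g i)\<^sup>2 + \<alpha>)))) U"
    unfolding mat_inv_gram tikhonov_mat_eq[OF assms(1)]
    unfolding A_eq sandwich_mult[OF U_carrier V U_carrier] sandwich_mult[OF U_carrier U U_carrier] ..
  then have "mat_trace (mat_inv (A * transpose_mat A) * (A * tikhonov_mat A \<alpha>)) = (\<Sum>i<n. 1 / ((g i)\<^sup>2 + \<alpha>))"
    using g_pos by (simp add: sandwich_trace[OF U] power2_eq_square less_imp_neq[symmetric])
  then show ?thesis using 1 2 by (simp add: SURE_def)
qed

lemma observation_spectral:
  assumes x: "x \<in> carrier_vec n" and \<epsilon>: "\<epsilon> \<in> carrier_vec n" and i: "i < n"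
  shows "vec_index (transpose_mat U *\<^sub>v (A *\<^sub>v x + \<epsilon>)) i
    = g i * vec_index (transpose_mat V *\<^sub>v x) i + vec_index (transpose_mat U *\<^sub>v \<epsilon>) i"
proof -
  have Ax: "transpose_mat U *\<^sub>v (A *\<^sub>v x) = Matrix.vec n (\<lambda>i. g i * vec_index (transpose_mat V *\<^sub>v x) i)"
    unfolding A_eq sandwich_mult_vec[OF U_carrier V_carrier x]
    using orthogonal_realD[OF U] by (simp add: assoc_mult_mat_vec[of _ n n _ n, symmetric])
  have c: "A *\<^sub>v x \<in> carrier_vec n" "transpose_mat U *\<^sub>v \<epsilon> \<in> carrier_vec n"
    using A_carrier x U_carrier \<epsilon> by auto
  have "transpose_mat U *\<^sub>v (A *\<^sub>v x + \<epsilon>) = transpose_mat U *\<^sub>v (A *\<^sub>v x) + transpose_mat U *\<^sub>v \<epsilon>"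
    using U_carrier \<epsilon> c by (intro mult_add_distrib_mat_vec) auto
  then show ?thesis unfolding Ax using i c U_carrier by simp
qed

text \<open>The projector is the identity because \<open>A\<close> is invertible. In the basis
  \<open>V\<close> the error splits into a bias part, from 1 - g_i^2 / (g_i^2 + \<alpha>) = \<alpha>
  / (g_i^2 + \<alpha>), and a noise part.\<close>

lemma estimation_error_spectral:
  assumes "\<alpha> \<ge> 0" and x: "x \<in> carrier_vec n" and \<epsilon>: "\<epsilon> \<in> carrier_vec n"
  shows "sq_norm2 ((pseudo_inv A * A) *\<^sub>v (x - tikhonov A \<alpha> (A *\<^sub>v x + \<epsilon>)))
    = (\<Sum>i<n. (\<alpha> / ((g i)\<^sup>2 + \<alpha>) * vec_index (transpose_mat V *\<^sub>v x) i
           - g i / ((g i)\<^sup>2 + \<alpha>) * vec_index (transpose_mat U *\<^sub>v \<epsilon>) i)\<^sup>2)"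
proof -
  let ?\<xi> = "transpose_mat V *\<^sub>v x" and ?e = "transpose_mat U *\<^sub>v \<epsilon>"
  let ?I = "sandwich n V (\<lambda>i. 1 / g i) U"
  have I: "?I \<in> carrier_mat n n" using U_carrier V_carrier by simp
  have AI: "A * ?I = 1\<^sub>m n"
  proof -
    have "A * ?I = sandwich n U (\<lambda>i. g i * (1 / g i)) U"
      unfolding A_eq by (rule sandwich_mult[OF U_carrier V U_carrier])
    also have "\<dots> = sandwich n U (\<lambda>i. 1) U" using g_pos by (intro sandwich_cong) (auto simp: less_imp_neq[symmetric])
    finally show ?thesis by (simp add: sandwich_one[OF U])
  qed
  have "pseudo_inv A * A = 1\<^sub>m n"
    using pseudo_inv_eq_mat_inv[OF A_carrier I AI] mat_mult_left_right_inverse[OF A_carrier I AI] by simp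
  moreover have "x - tikhonov A \<alpha> (A *\<^sub>v x + \<epsilon>) = V *\<^sub>v (?\<xi> - Matrix.vec n (\<lambda>i. g i / ((g i)\<^sup>2 + \<alpha>) * (g i * vec_index ?\<xi> i + vec_index ?e i)))"
  proof -
    have "A *\<^sub>v x \<in> carrier_vec n" using A_carrier x by auto
    then have "A *\<^sub>v x + \<epsilon> \<in> carrier_vec n" using \<epsilon> by simp
    note sandwich_mult_vec[OF V_carrier U_carrier this]
    moreover have "Matrix.vec n (\<lambda>i. g i / ((g i)\<^sup>2 + \<alpha>) * vec_index (transpose_mat U *\<^sub>v (A *\<^sub>v x + \<epsilon>)) i)
       = Matrix.vec n (\<lambda>i. g i / ((g i)\<^sup>2 + \<alpha>) * (g i * vec_index ?\<xi> i + vec_index ?e i))"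
      by (rule eq_vecI) (simp_all only: observation_spectral[OF x \<epsilon>] index_vec dim_vec)
    ultimately have "tikhonov A \<alpha> (A *\<^sub>v x + \<epsilon>) = V *\<^sub>v Matrix.vec n (\<lambda>i. g i / ((g i)\<^sup>2 + \<alpha>) * (g i * vec_index ?\<xi> i + vec_index ?e i))"
      unfolding tikhonov_def tikhonov_mat_eq[OF assms(1)] by simp
    moreover have "x = V *\<^sub>v ?\<xi>" using orthogonal_realD[OF V] x by (simp add: assoc_mult_mat_vec[of _ n n _ n, symmetric])
    moreover have "?\<xi> \<in> carrier_vec n" using V_carrier x by auto
    ultimately show ?thesis
      using mult_minus_distrib_mat_vec[OF V_carrier, of ?\<xi> "Matrix.vec n (\<lambda>i. g i / ((g i)\<^sup>2 + \<alpha>) * (g i * vec_index ?\<xi> i + vec_index ?e i))"]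
      by simp
  qed
  moreover have "1\<^sub>m n *\<^sub>v (V *\<^sub>v w) = V *\<^sub>v w" if "w \<in> carrier_vec n" for w
    using V_carrier that by simp
  moreover have "?\<xi> - Matrix.vec n h \<in> carrier_vec n" for h using V_carrier x by auto
  ultimately have "sq_norm2 ((pseudo_inv A * A) *\<^sub>v (x - tikhonov A \<alpha> (A *\<^sub>v x + \<epsilon>)))
    = sq_norm2 (?\<xi> - Matrix.vec n (\<lambda>i. g i / ((g i)\<^sup>2 + \<alpha>) * (g i * vec_index ?\<xi> i + vec_index ?e i)))"
    using sq_norm2_orthogonal[OF V] by simp
  also have "\<dots> = (\<Sum>i<n. (vec_index ?\<xi> i - g i / ((g i)\<^sup>2 + \<alpha>) * (g i * vec_index ?\<xi> i + vec_index ?e i))\<^sup>2)"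
    using V_carrier x by (subst sq_norm2_sum[of _ n]) auto
  also have "\<dots> = (\<Sum>i<n. (\<alpha> / ((g i)\<^sup>2 + \<alpha>) * vec_index ?\<xi> i - g i / ((g i)\<^sup>2 + \<alpha>) * vec_index ?e i)\<^sup>2)"
  proof (intro sum.cong refl)
    fix i assume "i \<in> {..<n}"
    then have D: "(g i)\<^sup>2 + \<alpha> > 0" using g_pos[of i] assms(1) by (simp add: add_pos_nonneg)
    have "t - g i / ((g i)\<^sup>2 + \<alpha>) * (g i * t + e) = \<alpha> / ((g i)\<^sup>2 + \<alpha>) * t - g i / ((g i)\<^sup>2 + \<alpha>) * e" for t e
    proof -
      \<comment> \<open>The denominator is kept as one letter; its excess over g_i^2 is
        \<alpha>.\<close>
      have "t - g i / D * (g i * t + e) = (D - (g i)\<^sup>2) / D * t - g i / D * e" if "D \<noteq> 0" for D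
        using that by (simp add: field_simps power2_eq_square)
      from this[of "(g i)\<^sup>2 + \<alpha>"] D show ?thesis by simp
    qed
    then show "(vec_index ?\<xi> i - g i / ((g i)\<^sup>2 + \<alpha>) * (g i * vec_index ?\<xi> i + vec_index ?e i))\<^sup>2
      = (\<alpha> / ((g i)\<^sup>2 + \<alpha>) * vec_index ?\<xi> i - g i / ((g i)\<^sup>2 + \<alpha>) * vec_index ?e i)\<^sup>2" by simp
  qed
  finally show ?thesis .
qed

end

text \<open>Diagonalising A^T A gives \<open>V\<close> and the squares of the \<open>g i\<close>,
  and U = A V diag(1/g) is then orthogonal; positivity of the smallest singular value makes the
  division legitimate. The \<open>g i\<close> come unordered, so only their bounds by the extreme
  singular values are recorded.\<close>

lemma real_svd_exists:
  assumes A: "A \<in> carrier_mat n n" and n: "n \<ge> 1" and pos: "singular_value A n > 0"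
  shows "\<exists>U V g. real_svd n A U V g \<and> (\<forall>i<n. singular_value A n \<le> g i \<and> g i \<le> singular_value A 1)"
proof -
  define B where "B = transpose_mat A * A"
  have B: "B \<in> carrier_mat n n" using A by (simp add: B_def)
  have "transpose_mat B = B" using A by (simp add: B_def transpose_mult[of _ n n _ n])
  then obtain V l where V: "V \<in> carrier_mat n n" "transpose_mat V * V = 1\<^sub>m n"
      and diag: "transpose_mat V * B * V = mat_diag n l"
    using real_spectral_theorem[OF B] by blast
  then have oV: "orthogonal_real n V" by (simp add: orthogonal_real_def)
  note V' = orthogonal_realD[OF oV]
  note assoc = assoc_mult_mat[of _ n n _ n _ n] mult_carrier_mat[of _ n n _ n]
  have "B = (V * transpose_mat V) * B * (V * transpose_mat V)" using V' B by simp
  also have "\<dots> = V * (transpose_mat V * B * V) * transpose_mat V" using V'(1,2) B by (simp add: assoc)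
  finally have B_eq: "B = V * mat_diag n l * transpose_mat V" by (simp add: diag)
  \<comment> \<open>Similar matrices share the characteristic polynomial, so its roots with
    multiplicity are the diagonal entries \<open>l i\<close>.\<close>
  have "similar_mat B (mat_diag n l)"
    unfolding similar_mat_def
    by (intro exI, rule similar_mat_witI[OF V'(4,3) B_eq B _ V'(1,2)]) simp
  then have "char_poly B = char_poly (mat_diag n l)" by (rule char_poly_similar)
  also have "\<dots> = (\<Prod>a\<leftarrow>diag_mat (mat_diag n l). [:- a, 1:])"
    by (rule char_poly_upper_triangular[of _ n]) (auto simp: mat_diag_def)
  also have "diag_mat (mat_diag n l) = map l [0..<n]" by (auto simp: diag_mat_def mat_diag_def)
  finally have "char_poly B = (\<Prod>a\<leftarrow>map l [0..<n]. [:- a, 1:])" .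
  moreover have "proots (\<Prod>a\<leftarrow>as. [:- a, 1:]) = mset as" for as :: "real list"
  proof (induction as)
    case (Cons a as)
    have "(\<Prod>a\<leftarrow>as. [:- a, 1:]) \<noteq> 0" by (auto simp: prod_list_zero_iff)
    then show ?case using Cons by (simp add: proots_mult del: mult_pCons_left)
  qed simp
  ultimately have "proots (char_poly B) = mset (map l [0..<n])" by (simp only:)
  then have L: "singular_values A = rev (sorted_list_of_multiset (mset (map (\<lambda>i. sqrt (l i)) [0..<n])))"
    by (simp add: singular_values_def B_def multiset.map_comp comp_def)
  then have ms: "mset (singular_values A) = mset (map (\<lambda>i. sqrt (l i)) [0..<n])" by simp
  then have len: "length (singular_values A) = n" by (metis size_mset length_map diff_zero length_upt)
  have dec: "singular_values A ! j \<le> singular_values A ! i" if "i \<le> j" "j < n" for i j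
    unfolding L using that len[unfolded L] sorted_sorted_list_of_multiset
    by (auto intro!: sorted_rev_nth_mono)
  have bd: "singular_value A n \<le> sqrt (l i) \<and> sqrt (l i) \<le> singular_value A 1" if "i < n" for i
  proof -
    have "sqrt (l i) \<in> set (singular_values A)" using that by (simp add: mset_eq_setD[OF ms])
    then obtain k where "k < n" "sqrt (l i) = singular_values A ! k" using len by (metis in_set_conv_nth)
    \<comment> \<open>Indices are shifted: \<open>singular_value A n\<close> is the list entry
      \<open>n - 1\<close> and \<open>singular_value A 1\<close> is entry 0.\<close>
    then show ?thesis using dec[of k "n - 1"] dec[of 0 k] n by (simp add: singular_value_def)
  qed
  define g where "g i = sqrt (l i)" for i
  have g: "g i > 0" if "i < n" for i using bd[OF that] pos unfolding g_def by linarith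
  \<comment> \<open>\<open>sqrt\<close> is odd on the reals, so \<open>g i > 0\<close> yields
    \<open>l i > 0\<close>, and squaring recovers \<open>l i\<close>.\<close>
  have l: "l i = g i * g i" if "i < n" for i using g[OF that] by (simp add: g_def)
  define U where "U = A * V * mat_diag n (\<lambda>i. 1 / g i)"
  have U: "U \<in> carrier_mat n n" using A V by (simp add: U_def mult_carrier_mat[of _ n n _ n])
  have tU: "transpose_mat U = mat_diag n (\<lambda>i. 1 / g i) * (transpose_mat V * transpose_mat A)"
  proof -
    have "transpose_mat (mat_diag n f) = mat_diag n f" for f :: "nat \<Rightarrow> real"
      by (rule eq_matI) (auto simp: mat_diag_def)
    then show ?thesis unfolding U_def using A V by (simp add: transpose_mult[of _ n n _ n])
  qed
  \<comment> \<open>\<open>V\<close> turns A^T A into diag(l), so U^T U has diagonal entries l_i /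
    g_i^2 = 1.\<close>
  have "transpose_mat U * U = mat_diag n (\<lambda>i. 1 / g i) * (transpose_mat V * B * V) * mat_diag n (\<lambda>i. 1 / g i)"
    unfolding tU unfolding U_def B_def using A V by (simp add: assoc)
  also have "\<dots> = mat_diag n (\<lambda>i. 1 / g i * l i * (1 / g i))" unfolding diag by simp
  also have "\<dots> = 1\<^sub>m n" by (rule eq_matI) (auto simp: mat_diag_def l, metis g less_irrefl)
  finally have oU: "orthogonal_real n U" using U by (simp add: orthogonal_real_def)
  have "sandwich n U g V = A * (V * (mat_diag n (\<lambda>i. 1 / g i) * mat_diag n g) * transpose_mat V)"
    unfolding sandwich_def U_def using A V by (simp add: assoc del: mat_diag_diag)
  also have "mat_diag n (\<lambda>i. 1 / g i) * mat_diag n g = 1\<^sub>m n"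
    unfolding mat_diag_diag by (rule eq_matI) (auto simp: mat_diag_def, metis g less_irrefl)
  finally have "A = sandwich n U g V" using A V' by simp
  then have "real_svd n A U V g" using oU oV g by unfold_locales auto
  then show ?thesis using bd unfolding g_def by blast
qed

subsection \<open>A majorant of the Tikhonov weights\<close>

text \<open>With H = sum_i \<eta>_i h_i, the sum being squared is F, the integral of s H(s) over
  [0,u]. Cauchy-Schwarz with the weight 2 s, whose mass on [0,u] is u^2 \<le> 1, bounds F^2 by the
  integral of (s/2) H(s)^2 over [0,1]; expanding the square yields \<open>K\<close>, independent of
  u and \<eta>.\<close>

lemma quadratic_majorant:
  fixes c h :: "nat \<Rightarrow> real \<Rightarrow> real"
  assumes cont: "\<And>i. i < n \<Longrightarrow> continuous_on {0..1} (h i)"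
    and bound: "\<And>i s. i < n \<Longrightarrow> s \<in> {0..1} \<Longrightarrow> \<bar>h i s\<bar> \<le> 2"
    and int: "\<And>i u. i < n \<Longrightarrow> u \<in> {0..1} \<Longrightarrow> ((\<lambda>s. s * h i s) has_integral c i u) {0..u}"
  shows "\<exists>K. (\<forall>i<n. K i i \<le> 1) \<and> (\<forall>\<eta>. \<forall>u\<in>{0..1}. 
     (\<Sum>i<n. c i u * \<eta> i)\<^sup>2 \<le> (\<Sum>i<n. \<Sum>j<n. K i j * (\<eta> i * \<eta> j)))"
proof -
  \<comment> \<open>The factor \<open>s / 2\<close> is s^2 divided by the weight 2 s.\<close>
  define k where "k i j s = s / 2 * h i s * h j s" for i j s
  define K where "K i j = integral {0..1} (k i j)" for i j
  have k: "(k i j has_integral K i j) {0..1}" if "i < n" "j < n" for i j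
    unfolding K_def k_def using that
    by (intro integrable_integral integrable_continuous_interval continuous_intros cont) auto
  have id: "((\<lambda>s. 2 * s) has_integral u\<^sup>2) {0..u}" if "u \<in> {0..1}" for u :: real
  proof -
    have "((\<lambda>s. 2 * s) has_integral (u\<^sup>2 - 0\<^sup>2)) {0..u}"
      using that by (intro fundamental_theorem_of_calculus)
        (auto simp: has_real_derivative_iff_has_vector_derivative[symmetric] intro!: derivative_eq_intros)
    then show ?thesis by simp
  qed
  have "K i i \<le> 1" if "i < n" for i
  proof (rule has_integral_le[OF k[OF that that]])
    show "((\<lambda>s. 2 * s) has_integral 1) {0..1::real}" using id[of 1] by simp
    fix s :: real assume s: "s \<in> {0..1}"
    have "(h i s)\<^sup>2 \<le> 2\<^sup>2" using bound[OF that s] by (intro abs_le_square_iff[THEN iffD1]) auto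
    then have "s * (h i s)\<^sup>2 \<le> s * 4" using s by (intro mult_left_mono) auto
    then show "k i i s \<le> 2 * s" by (simp add: k_def power2_eq_square mult_ac)
  qed
  moreover have "(\<Sum>i<n. c i u * \<eta> i)\<^sup>2 \<le> (\<Sum>i<n. \<Sum>j<n. K i j * (\<eta> i * \<eta> j))" if u: "u \<in> {0..1}" for \<eta> u
  proof -
    define H where "H s = (\<Sum>i<n. \<eta> i * h i s)" for s
    define F where "F = (\<Sum>i<n. c i u * \<eta> i)"
    define P where "P = (\<Sum>i<n. \<Sum>j<n. K i j * (\<eta> i * \<eta> j))"
    have H: "((\<lambda>s. s * H s) has_integral F) {0..u}"
    proof -
      have "((\<lambda>s. \<Sum>i<n. (s * h i s) * \<eta> i) has_integral F) {0..u}"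
        unfolding F_def by (intro has_integral_sum has_integral_mult_left int u) auto
      then show ?thesis by (simp add: H_def sum_distrib_left mult_ac)
    qed
    have HH: "((\<lambda>s. s / 2 * (H s)\<^sup>2) has_integral P) {0..1}"
    proof -
      have "((\<lambda>s. \<Sum>i<n. \<Sum>j<n. k i j s * (\<eta> i * \<eta> j)) has_integral P) {0..1}"
        unfolding P_def by (intro has_integral_sum has_integral_mult_left k) auto
      moreover have "(\<Sum>i<n. \<Sum>j<n. k i j s * (\<eta> i * \<eta> j)) = s / 2 * (H s)\<^sup>2" for s
        unfolding k_def H_def power2_eq_square sum_product by (simp add: sum_distrib_left mult_ac)
      ultimately show ?thesis by simp
    qed
    have contH: "continuous_on {0..1} H" unfolding H_def by (intro continuous_intros cont) auto
    have "continuous_on {0..u} H" by (rule continuous_on_subset[OF contH]) (use u in auto)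
    then have Q: "((\<lambda>s. s / 2 * (H s)\<^sup>2) has_integral integral {0..u} (\<lambda>s. s / 2 * (H s)\<^sup>2)) {0..u}"
      by (intro integrable_integral integrable_continuous_interval continuous_intros) auto
    \<comment> \<open>This is the integral of \<open>2 s (H s / 2 - F)\<^sup>2\<close>; as \<open>u \<le> 1\<close>, centring at \<open>F\<close> instead of
      the optimal \<open>F / u\<^sup>2\<close> loses nothing and avoids the case \<open>u = 0\<close>.\<close>
    have "((\<lambda>s. s / 2 * (H s)\<^sup>2 - 2 * F * (s * H s) + F\<^sup>2 * (2 * s)) has_integral
        integral {0..u} (\<lambda>s. s / 2 * (H s)\<^sup>2) - 2 * F * F + F\<^sup>2 * u\<^sup>2) {0..u}"
      by (intro has_integral_add has_integral_diff has_integral_mult_right Q H id u)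
    then have "0 \<le> integral {0..u} (\<lambda>s. s / 2 * (H s)\<^sup>2) - 2 * F * F + F\<^sup>2 * u\<^sup>2"
    proof (rule has_integral_nonneg)
      fix s assume "s \<in> {0..u}"
      then have "0 \<le> 2 * s * (H s / 2 - F)\<^sup>2" by auto
      also have "\<dots> = s / 2 * (H s)\<^sup>2 - 2 * F * (s * H s) + F\<^sup>2 * (2 * s)"
        by (simp add: power2_eq_square algebra_simps)
      finally show "0 \<le> s / 2 * (H s)\<^sup>2 - 2 * F * (s * H s) + F\<^sup>2 * (2 * s)" .
    qed
    moreover have "F\<^sup>2 * u\<^sup>2 \<le> F\<^sup>2 * 1" using u by (intro mult_left_mono power_le_one) auto
    \<comment> \<open>The integrand is nonnegative, so [0,u] may be enlarged to [0,1]; this removes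
      the dependence on u.\<close>
    moreover have "integral {0..u} (\<lambda>s. s / 2 * (H s)\<^sup>2) \<le> P"
      by (rule has_integral_subset_le[OF _ Q HH]) (use u in auto)
    ultimately show ?thesis unfolding F_def[symmetric] P_def[symmetric] by (simp add: power2_eq_square)
  qed
  ultimately show ?thesis by blast
qed

text \<open>With u = \<alpha> / (\<gamma>^2 + \<alpha>) and \<rho>_i = (\<gamma> / g_i)^2, the
  filter \<alpha> / (g_i^2 + \<alpha>) equals \<rho>_i u / d_i(u). The weight then has derivative 2
  u (\<rho>_i / d_i)^3, which d_i \<ge> \<rho>_i keeps below 2 u. The prefactor \<rho>_i, due to the
  scaling by the squared condition number, supplies the third power of \<rho>_i and so makes the
  bound free of \<gamma>.\<close>

lemma tikhonov_weights_majorant: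
  fixes g :: "nat \<Rightarrow> real"
  assumes \<gamma>: "\<gamma> > 0" and g: "\<And>i. i < n \<Longrightarrow> \<gamma> \<le> g i"
  shows "\<exists>K. (\<forall>i<n. K i i \<le> 1) \<and> (\<forall>\<eta>. \<forall>\<alpha>\<ge>0.
     (\<Sum>i<n. (\<gamma> / g i)\<^sup>2 * (\<alpha> / ((g i)\<^sup>2 + \<alpha>))\<^sup>2 * \<eta> i)\<^sup>2 \<le> (\<Sum>i<n. \<Sum>j<n. K i j * (\<eta> i * \<eta> j)))"
proof -
  define \<rho> where "\<rho> i = (\<gamma> / g i)\<^sup>2" for i
  define d where "d i s = 1 - (1 - \<rho> i) * s" for i s
  define h where "h i s = 2 * (\<rho> i / d i s) ^ 3" for i s
  define c where "c i u = \<rho> i * (\<rho> i * u / d i u)\<^sup>2" for i u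
  have \<rho>: "0 < \<rho> i" "\<rho> i \<le> 1" if "i < n" for i
    using \<gamma> g[OF that] by (auto simp: \<rho>_def intro!: power_le_one)
  \<comment> \<open>\<open>d i\<close> is affine, with value 1 at 0 and \<rho>_i \<le> 1 at
    1.\<close>
  have d: "\<rho> i \<le> d i s" if "i < n" "s \<in> {0..1}" for i s
    using \<rho>[OF that(1)] that(2) mult_left_mono[of s 1 "1 - \<rho> i"] by (auto simp: d_def)
  have d0: "d i s > 0" if "i < n" "s \<in> {0..1}" for i s
    using d[OF that] \<rho>(1)[OF that(1)] by simp
  have "\<exists>K. (\<forall>i<n. K i i \<le> 1) \<and> (\<forall>\<eta>. \<forall>u\<in>{0..1}. 
     (\<Sum>i<n. c i u * \<eta> i)\<^sup>2 \<le> (\<Sum>i<n. \<Sum>j<n. K i j * (\<eta> i * \<eta> j)))"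
  proof (rule quadratic_majorant)
    fix i assume i: "i < n"
    have "continuous_on {0..1} (d i)" unfolding d_def by (intro continuous_intros)
    then show "continuous_on {0..1} (h i)" unfolding h_def
      by (intro continuous_intros) (use d0[OF i] in \<open>auto simp: less_imp_neq[symmetric]\<close>)
    show "\<bar>h i s\<bar> \<le> 2" if s: "s \<in> {0..1}" for s
      using d0[OF i s] d[OF i s] \<rho>[OF i] by (simp add: h_def abs_mult power_le_one)
    show "((\<lambda>s. s * h i s) has_integral c i u) {0..u}" if u: "u \<in> {0..1}" for u
    proof -
      have "((\<lambda>s. s * h i s) has_integral (c i u - c i 0)) {0..u}"
      proof (rule fundamental_theorem_of_calculus)
        fix s assume "s \<in> {0..u}"
        then have "d i s > 0" using d0[OF i] u by auto
        then have ds: "1 - (1 - \<rho> i) * s \<noteq> 0" "d i s \<noteq> 0" by (auto simp: d_def)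
        \<comment> \<open>The derivative is stated in the raw form of the quotient rule; its
          numerator then collapses to \<open>\<rho> i\<close>.\<close>
        have "(c i has_real_derivative 
           \<rho> i * (2 * (\<rho> i * s / d i s) * ((\<rho> i * d i s + \<rho> i * s * (1 - \<rho> i)) / (d i s * d i s)))) (at s within {0..u})"
          unfolding c_def d_def
          by (rule derivative_eq_intros refl ds(1))+ (simp add: algebra_simps)
        also have "\<rho> i * d i s + \<rho> i * s * (1 - \<rho> i) = \<rho> i" by (simp add: d_def algebra_simps)
        also have "\<rho> i * (2 * (\<rho> i * s / d i s) * (\<rho> i / (d i s * d i s))) = s * h i s"
          using ds(2) by (simp add: h_def power3_eq_cube mult_ac)
        finally show "(c i has_vector_derivative s * h i s) (at s within {0..u})"
          by (simp add: has_real_derivative_iff_has_vector_derivative)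
      qed (use u in auto)
      \<comment> \<open>The boundary term \<open>c i 0\<close> is zero.\<close>
      then show ?thesis by (simp add: c_def)
    qed
  qed
  then obtain K where K: "\<forall>i<n. K i i \<le> 1"
    "\<And>\<eta> u. u \<in> {0..1} \<Longrightarrow> (\<Sum>i<n. c i u * \<eta> i)\<^sup>2 \<le> (\<Sum>i<n. \<Sum>j<n. K i j * (\<eta> i * \<eta> j))"
    by blast
  have "(\<Sum>i<n. (\<gamma> / g i)\<^sup>2 * (\<alpha> / ((g i)\<^sup>2 + \<alpha>))\<^sup>2 * \<eta> i)\<^sup>2 \<le> (\<Sum>i<n. \<Sum>j<n. K i j * (\<eta> i * \<eta> j))"
    if "\<alpha> \<ge> 0" for \<eta> \<alpha>
  proof -
    define u where "u = \<alpha> / (\<gamma>\<^sup>2 + \<alpha>)"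
    have pos: "\<gamma>\<^sup>2 + \<alpha> > 0" using \<gamma> that by (simp add: add_pos_nonneg)
    have "c i u = (\<gamma> / g i)\<^sup>2 * (\<alpha> / ((g i)\<^sup>2 + \<alpha>))\<^sup>2" if i: "i < n" for i
    proof -
      have gi: "g i > 0" using g[OF i] \<gamma> by simp
      have p: "(g i)\<^sup>2 + \<alpha> > 0" using gi \<open>\<alpha> \<ge> 0\<close> by (simp add: add_pos_nonneg)
      have "d i u = \<gamma>\<^sup>2 * ((g i)\<^sup>2 + \<alpha>) / ((g i)\<^sup>2 * (\<gamma>\<^sup>2 + \<alpha>))"
      proof -
        \<comment> \<open>Here \<open>a\<close>, \<open>b\<close>, \<open>p\<close> stand for
          \<gamma>^2, g_i^2 and \<gamma>^2 + \<alpha>, so that \<alpha> is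
          \<open>p - a\<close>.\<close>
        have "1 - (1 - a / b) * ((p - a) / p) = a * (b + (p - a)) / (b * p)" if "b \<noteq> 0" "p \<noteq> 0" for a b p :: real
          using that by (simp add: field_simps)
        from this[of "(g i)\<^sup>2" "\<gamma>\<^sup>2 + \<alpha>" "\<gamma>\<^sup>2"] pos gi show ?thesis
          by (simp add: d_def u_def \<rho>_def power_divide)
      qed
      then have "\<rho> i * u / d i u = \<alpha> / ((g i)\<^sup>2 + \<alpha>)"
        using pos p gi \<gamma> by (simp add: u_def \<rho>_def power_divide)
      then show ?thesis by (simp add: c_def \<rho>_def)
    qed
    moreover have "u \<in> {0..1}" using pos that by (simp add: u_def)
    ultimately show ?thesis using K(2)[of u \<eta>] by simp
  qed
  then show ?thesis using K(1) by blast
qed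

subsection \<open>Moments of Gaussian linear forms\<close>

context prob_space
begin

lemma isotropic_gaussian_linear_form:
  assumes X: "isotropic_gaussian M n \<sigma> X" and \<sigma>: "\<sigma> > 0" and s: "(\<Sum>i<n. (a i)\<^sup>2) > 0"
  shows "distributed M lborel (\<lambda>\<omega>. \<Sum>i<n. a i * vec_index (X \<omega>) i)
     (normal_density 0 (\<sigma> * sqrt (\<Sum>i<n. (a i)\<^sup>2)))"
proof -
  \<comment> \<open>Terms with \<open>a i = 0\<close> have a degenerate law without density and are
    dropped; the hypothesis on the sum of squares keeps \<open>I\<close> nonempty, as the addition
    rule for Gaussians requires.\<close>
  define I where "I = {i. i < n \<and> a i \<noteq> 0}"
  have I: "finite I" "I \<subseteq> {..<n}" by (auto simp: I_def)
  have eqI: "(\<Sum>i<n. f i) = (\<Sum>i\<in>I. f i)" if "\<And>i. a i = 0 \<Longrightarrow> f i = 0" for f :: "nat \<Rightarrow> real"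
    by (rule sum.mono_neutral_right) (use I that in \<open>auto simp: I_def\<close>)
  have "I \<noteq> {}" using s eqI[of "\<lambda>i. (a i)\<^sup>2"] by auto
  have "indep_vars (\<lambda>_. borel) (\<lambda>i \<omega>. vec_index (X \<omega>) i) I"
    using X I by (auto simp: isotropic_gaussian_def intro: indep_vars_subset)
  then have ind: "indep_vars (\<lambda>_. borel) (\<lambda>i \<omega>. a i * vec_index (X \<omega>) i) I"
    by (rule indep_vars_compose2) auto
  have "distributed M lborel (\<lambda>\<omega>. \<Sum>i\<in>I. a i * vec_index (X \<omega>) i)
     (normal_density (\<Sum>i\<in>I. 0) (sqrt (\<Sum>i\<in>I. (\<bar>a i\<bar> * \<sigma>)\<^sup>2)))"
  proof (rule sum_indep_normal[OF I(1) \<open>I \<noteq> {}\<close> ind])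
    fix i assume i: "i \<in> I"
    then show "0 < \<bar>a i\<bar> * \<sigma>" using \<sigma> by (simp add: I_def)
    have "distributed M lborel (\<lambda>\<omega>. vec_index (X \<omega>) i) (normal_density 0 \<sigma>)"
      using X i by (auto simp: isotropic_gaussian_def I_def)
    from normal_density_affine[OF this \<sigma>, of "a i" 0] i
    show "distributed M lborel (\<lambda>\<omega>. a i * vec_index (X \<omega>) i) (normal_density 0 (\<bar>a i\<bar> * \<sigma>))"
      by (simp add: I_def)
  qed
  moreover have "sqrt (\<Sum>i\<in>I. (\<bar>a i\<bar> * \<sigma>)\<^sup>2) = \<sigma> * sqrt (\<Sum>i<n. (a i)\<^sup>2)"
    using \<sigma> by (simp add: eqI[of "\<lambda>i. (a i)\<^sup>2"] power_mult_distrib sum_distrib_right[symmetric] real_sqrt_mult)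
  ultimately show ?thesis by (simp add: eqI)
qed

lemma isotropic_gaussian_moments:
  assumes X: "isotropic_gaussian M n \<sigma> X" and \<sigma>: "\<sigma> > 0"
  defines "L a \<omega> \<equiv> \<Sum>i<n. a i * vec_index (X \<omega>) i"
  shows "has_bochner_integral M (\<lambda>\<omega>. L a \<omega>) 0"
    and "has_bochner_integral M (\<lambda>\<omega>. (L a \<omega>)\<^sup>2) (\<sigma>\<^sup>2 * (\<Sum>i<n. (a i)\<^sup>2))"
    and "has_bochner_integral M (\<lambda>\<omega>. (L a \<omega>)^3) 0"
    and "has_bochner_integral M (\<lambda>\<omega>. (L a \<omega>)^4) (3 * \<sigma>^4 * (\<Sum>i<n. (a i)\<^sup>2)\<^sup>2)"
proof -
  define s where "s = (\<Sum>i<n. (a i)\<^sup>2)"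
  have "has_bochner_integral M (\<lambda>\<omega>. L a \<omega>) 0 \<and> has_bochner_integral M (\<lambda>\<omega>. (L a \<omega>)\<^sup>2) (\<sigma>\<^sup>2 * s)
    \<and> has_bochner_integral M (\<lambda>\<omega>. (L a \<omega>)^3) 0 \<and> has_bochner_integral M (\<lambda>\<omega>. (L a \<omega>)^4) (3 * \<sigma>^4 * s\<^sup>2)"
  proof (cases "s > 0")
    \<comment> \<open>For a = 0 the form is constantly 0 and has no density, so its moments are
      found directly.\<close>
    case False
    then have "s = 0" by (metis s_def sum_nonneg zero_le_power2 order_le_less)
    then have "a i = 0" if "i < n" for i using that by (auto simp: s_def sum_nonneg_eq_0_iff)
    then have "L a = (\<lambda>_. 0)" by (auto simp: L_def)
    then show ?thesis using \<open>s = 0\<close> by (simp add: has_bochner_integral_zero)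
  next
    case True
    define \<tau> where "\<tau> = \<sigma> * sqrt s"
    have \<tau>: "\<tau> > 0" "\<tau>\<^sup>2 = \<sigma>\<^sup>2 * s" using \<sigma> True by (auto simp: \<tau>_def power_mult_distrib)
    have D: "distributed M lborel (L a) (normal_density 0 \<tau>)"
      using isotropic_gaussian_linear_form[OF X \<sigma> True[unfolded s_def]] by (simp add: L_def[abs_def] \<tau>_def s_def)
    have transfer: "has_bochner_integral M (\<lambda>\<omega>. (L a \<omega>) ^ k) v"
      if "has_bochner_integral lborel (\<lambda>x. normal_density 0 \<tau> x * (x - 0) ^ k) v" for k v
      using that distributed_integrable[OF D, of "\<lambda>x. x ^ k"] distributed_integral[OF D, of "\<lambda>x. x ^ k"]
      by (auto simp: has_bochner_integral_iff)
    have 4: "3 * \<sigma>^4 * s\<^sup>2 = 3 * (\<sigma>\<^sup>2 * s)\<^sup>2" by (simp add: power_mult_distrib flip: power_mult)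
    \<comment> \<open>The normal moments have orders 2k+1 and 2k: orders 1 and 3 are the odd cases k
      = 0, 1, orders 2 and 4 the even cases k = 1, 2.\<close>
    show ?thesis unfolding 4
      using transfer[OF normal_moment_odd[OF \<tau>(1), of 0 0]] transfer[OF normal_moment_odd[OF \<tau>(1), of 0 1]]
        transfer[OF normal_moment_even[OF \<tau>(1), of 0 1]] transfer[OF normal_moment_even[OF \<tau>(1), of 0 2]] \<tau>
      by (auto simp: fact_numeral power_divide)
  qed
  then show "has_bochner_integral M (\<lambda>\<omega>. L a \<omega>) 0"
    and "has_bochner_integral M (\<lambda>\<omega>. (L a \<omega>)\<^sup>2) (\<sigma>\<^sup>2 * (\<Sum>i<n. (a i)\<^sup>2))"
    and "has_bochner_integral M (\<lambda>\<omega>. (L a \<omega>)^3) 0"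
    and "has_bochner_integral M (\<lambda>\<omega>. (L a \<omega>)^4) (3 * \<sigma>^4 * (\<Sum>i<n. (a i)\<^sup>2)\<^sup>2)"
    by (auto simp: s_def)
qed

end

text \<open>Serves to assemble an expectation from known ones: linearity produces a combination, and
  algebra matches its integrand and value with the goal.\<close>

lemma has_bochner_integral_eqI:
  assumes "has_bochner_integral M f a" "\<And>x. f x = g x" "a = b"
  shows "has_bochner_integral M g b"
  using assms by (metis ext)

lemma (in prob_space) has_bochner_integral_prob_const: "has_bochner_integral M (\<lambda>_. c) (c::real)"
  by (simp add: has_bochner_integral_iff prob_space)

text \<open>The square expands to X^4 + 2 p X^3 + (p^2 - 2 \<sigma>^2) X^2 - 2 p \<sigma>^2 X +
  \<sigma>^4, and the odd moments vanish.\<close>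

lemma (in prob_space) centered_square_variance:
  fixes X :: "'a \<Rightarrow> real"
  assumes m: "has_bochner_integral M X 0" "has_bochner_integral M (\<lambda>\<omega>. (X \<omega>)\<^sup>2) (\<sigma>\<^sup>2)"
    "has_bochner_integral M (\<lambda>\<omega>. (X \<omega>)^3) 0" "has_bochner_integral M (\<lambda>\<omega>. (X \<omega>)^4) (3 * \<sigma>^4)"
  shows "has_bochner_integral M (\<lambda>\<omega>. (p * X \<omega> + (X \<omega>)\<^sup>2 - \<sigma>\<^sup>2)\<^sup>2) (p\<^sup>2 * \<sigma>\<^sup>2 + 2 * \<sigma>^4)"
proof -
  note add = has_bochner_integral_add and mul = has_bochner_integral_mult_right
  show ?thesis
    by (rule has_bochner_integral_eqI[OF add[OF add[OF m(4) mul[OF m(3), of "2 * p"]] add[OF mul[OF m(2), of "p\<^sup>2 - 2 * \<sigma>\<^sup>2"]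
          add[OF mul[OF m(1), of "-2 * p * \<sigma>\<^sup>2"] has_bochner_integral_prob_const[of "\<sigma>^4"]]]]])
      (auto simp: power2_eq_square power3_eq_cube power4_eq_xxxx algebra_simps)
qed

text \<open>The moments up to order four are those of two independent N(0, \<sigma>^2) variables.
  Stating them for linear combinations lets them be checked for rotated noise coordinates by
  orthogonality alone; polarization recovers the mixed moments.\<close>

locale standard_moments = prob_space +
  fixes X Y :: "'a \<Rightarrow> real" and \<sigma> :: real
  assumes m1: "\<And>a b. has_bochner_integral M (\<lambda>\<omega>. a * X \<omega> + b * Y \<omega>) 0"
    and m2: "\<And>a b. has_bochner_integral M (\<lambda>\<omega>. (a * X \<omega> + b * Y \<omega>)\<^sup>2) (\<sigma>\<^sup>2 * (a\<^sup>2 + b\<^sup>2))"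
    and m3: "\<And>a b. has_bochner_integral M (\<lambda>\<omega>. (a * X \<omega> + b * Y \<omega>)^3) 0"
    and m4: "\<And>a b. has_bochner_integral M (\<lambda>\<omega>. (a * X \<omega> + b * Y \<omega>)^4) (3 * \<sigma>^4 * (a\<^sup>2 + b\<^sup>2)\<^sup>2)"
begin

text \<open>By polarization the mixed moments of orders two and three vanish and X^2 Y^2 has mean
  \<sigma>^4. The means of the expanded product add up to \<sigma>^4 - 2 \<sigma>^4 + \<sigma>^4 =
  0.\<close>

lemma centered_squares_uncorrelated:
  "has_bochner_integral M (\<lambda>\<omega>. (p * X \<omega> + (X \<omega>)\<^sup>2 - \<sigma>\<^sup>2) * (q * Y \<omega> + (Y \<omega>)\<^sup>2 - \<sigma>\<^sup>2)) 0"
proof -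
  note add = has_bochner_integral_add and mul = has_bochner_integral_mult_right
  have XY: "has_bochner_integral M (\<lambda>\<omega>. X \<omega> * Y \<omega>) 0"
    by (rule has_bochner_integral_eqI[OF mul[OF add[OF m2[of 1 1] mul[OF m2[of 1 "-1"], of "-1"]], of "1/4"]])
      (auto simp: power2_eq_square algebra_simps)
  have XXY: "has_bochner_integral M (\<lambda>\<omega>. (X \<omega>)\<^sup>2 * Y \<omega>) 0"
    by (rule has_bochner_integral_eqI[OF mul[OF add[OF add[OF m3[of 1 1] mul[OF m3[of 1 "-1"], of "-1"]] mul[OF m3[of 0 1], of "-2"]], of "1/6"]])
      (auto simp: power2_eq_square power3_eq_cube algebra_simps)
  have XYY: "has_bochner_integral M (\<lambda>\<omega>. X \<omega> * (Y \<omega>)\<^sup>2) 0"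
    by (rule has_bochner_integral_eqI[OF mul[OF add[OF add[OF m3[of 1 1] m3[of 1 "-1"]] mul[OF m3[of 1 0], of "-2"]], of "1/6"]])
      (auto simp: power2_eq_square power3_eq_cube algebra_simps)
  \<comment> \<open>(X+Y)^4 + (X-Y)^4 - 2 X^4 - 2 Y^4 = 12 X^2 Y^2, and the left side has mean (12 +
    12 - 12) \<sigma>^4.\<close>
  have XXYY: "has_bochner_integral M (\<lambda>\<omega>. (X \<omega>)\<^sup>2 * (Y \<omega>)\<^sup>2) (\<sigma>^4)"
    by (rule has_bochner_integral_eqI[OF mul[OF add[OF add[OF m4[of 1 1] m4[of 1 "-1"]] 
          mul[OF add[OF m4[of 1 0] m4[of 0 1]], of "-2"]], of "1/12"]])
      (auto simp: power2_eq_square power4_eq_xxxx algebra_simps)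
  show ?thesis
    by (rule has_bochner_integral_eqI[OF add[OF add[OF add[OF mul[OF XY, of "p * q"] mul[OF XXY, of q]]
         add[OF mul[OF XYY, of p] XXYY]] add[OF mul[OF m1[of p q], of "-\<sigma>\<^sup>2"] 
         add[OF mul[OF add[OF m2[of 1 0] m2[of 0 1]], of "-\<sigma>\<^sup>2"] has_bochner_integral_prob_const[of "\<sigma>^4"]]]]])
      (auto simp: power2_eq_square power4_eq_xxxx algebra_simps)
qed

end

subsection \<open>The supremum of the error\<close>

text \<open>Reduces measurability of the supremum to a countable index set: by continuity, an upper
  bound at the dense rational points holds everywhere.\<close>

lemma SUP_real_eq_SUP_Rats:
  fixes f :: "real \<Rightarrow> real"
  assumes cont: "continuous_on {0..} f" and bdd: "bdd_above (f ` {0..})"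
  shows "(SUP \<alpha>\<in>{0..}. f \<alpha>) = (SUP \<alpha>\<in>{0..} \<inter> \<rat>. f \<alpha>)"
proof (rule antisym)
  have cl: "closure ({0..} \<inter> \<rat>) = {0::real..}"
  proof
    show "closure ({0..} \<inter> \<rat>) \<subseteq> {0::real..}" by (rule closure_minimal) auto
    show "{0::real..} \<subseteq> closure ({0..} \<inter> \<rat>)"
    proof
      fix x :: real assume x: "x \<in> {0..}"
      show "x \<in> closure ({0..} \<inter> \<rat>)" unfolding closure_approachable
      proof (intro allI impI)
        fix e :: real assume "e > 0"
        \<comment> \<open>Approximating \<open>x\<close> from the right keeps the rational point in
          \<open>{0..}\<close>.\<close>
        then obtain r where "r \<in> \<rat>" "x < r" "r < x + e" using Rats_dense_in_real[of x "x + e"] by auto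
        then show "\<exists>r\<in>{0..} \<inter> \<rat>. dist r x < e" using x by (intro bexI[of _ r]) (auto simp: dist_real_def)
      qed
    qed
  qed
  have bddQ: "bdd_above (f ` ({0..} \<inter> \<rat>))" by (rule bdd_above_mono[OF bdd]) auto
  show "(SUP \<alpha>\<in>{0..}. f \<alpha>) \<le> (SUP \<alpha>\<in>{0..} \<inter> \<rat>. f \<alpha>)"
  proof (rule cSUP_least)
    fix x :: real assume "x \<in> {0..}"
    then show "f x \<le> (SUP \<alpha>\<in>{0..} \<inter> \<rat>. f \<alpha>)"
      using continuous_le_on_closure[of "{0..} \<inter> \<rat>" f x] cont cl cSUP_upper[OF _ bddQ] by auto
  qed auto
  show "(SUP \<alpha>\<in>{0..} \<inter> \<rat>. f \<alpha>) \<le> (SUP \<alpha>\<in>{0..}. f \<alpha>)"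
    by (rule cSUP_subset_mono[OF _ bdd]) (auto intro: exI[of _ 0])
qed

text \<open>In singular coordinates the error is |F(\<alpha>)| / m, from which all three claims are
  read off. \<open>R\<close> dominates every \<alpha> at once, so its mean controls the supremum;
  measurability for fixed \<alpha> and continuity in \<alpha> serve to make the supremum
  measurable.\<close>

lemma scaled_error_majorant:
  fixes M :: "'w measure" and A :: "real mat"
  assumes M: "prob_space M" and \<sigma>: "\<sigma> > 0" and m: "m \<ge> 1" and A: "A \<in> carrier_mat m m"
    and x: "x \<in> carrier_vec m" and \<epsilon>: "isotropic_gaussian M m \<sigma> \<epsilon>"
    and y: "\<And>\<omega>. y \<omega> = A *\<^sub>v x + \<epsilon> \<omega>"
    and sv1: "singular_value A 1 = 1" and svm: "singular_value A m > 0"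
  shows "\<exists>R. integrable M R \<and> (\<integral>\<omega>. R \<omega> \<partial>M) \<le> (4 * \<sigma>\<^sup>2 * sq_norm2 x + 2 * real m * \<sigma>^4) / (real m)\<^sup>2 \<and>
     (\<forall>\<omega>\<in>space M. \<forall>\<alpha>\<ge>0. (scaled_error M A \<sigma> x y \<omega> \<alpha>)\<^sup>2 \<le> R \<omega>)"
    and "\<And>\<alpha>. \<alpha> \<ge> 0 \<Longrightarrow> (\<lambda>\<omega>. scaled_error M A \<sigma> x y \<omega> \<alpha>) \<in> borel_measurable M"
    and "\<And>\<omega>. \<omega> \<in> space M \<Longrightarrow> continuous_on {0..} (scaled_error M A \<sigma> x y \<omega>)"
proof -
  interpret prob_space M by (rule M)
  obtain U V g where "real_svd m A U V g"
    and g: "\<And>i. i < m \<Longrightarrow> singular_value A m \<le> g i" "\<And>i. i < m \<Longrightarrow> g i \<le> 1"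
    using real_svd_exists[OF A m svm] sv1 by auto
  then interpret real_svd m A U V g by simp
  define \<gamma> where "\<gamma> = singular_value A m"
  define \<xi> where "\<xi> i = vec_index (transpose_mat V *\<^sub>v x) i" for i
  \<comment> \<open>These are the coordinates of U^T \<epsilon>, written as sums so that the moments
    of linear forms apply. They agree with the matrix product on \<open>space M\<close>, where
    \<epsilon> has the right dimension.\<close>
  define e where "e i \<omega> = (\<Sum>k<m. U $$ (k,i) * vec_index (\<epsilon> \<omega>) k)" for i \<omega>
  define \<eta> where "\<eta> i \<omega> = 2 * g i * \<xi> i * e i \<omega> + (e i \<omega>)\<^sup>2 - \<sigma>\<^sup>2" for i \<omega>
  define D where "D i \<alpha> = (g i)\<^sup>2 + \<alpha>" for i \<alpha>
  have D: "D i \<alpha> > 0" if "i < m" "\<alpha> \<ge> 0" for i \<alpha>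
    using g_pos[OF that(1)] that(2) by (simp add: D_def add_pos_nonneg)
  have \<epsilon>_carrier: "\<epsilon> \<omega> \<in> carrier_vec m" if "\<omega> \<in> space M" for \<omega>
    using \<epsilon> that by (auto simp: isotropic_gaussian_def)
  have e_eq: "vec_index (transpose_mat U *\<^sub>v \<epsilon> \<omega>) i = e i \<omega>" if "\<omega> \<in> space M" "i < m" for i \<omega>
    using \<epsilon>_carrier[OF that(1)] that(2) U_carrier
    by (auto simp: e_def scalar_prod_def lessThan_atLeast0 intro!: sum.cong)
  have orth: "(\<Sum>k<m. U $$ (k,i) * U $$ (k,j)) = (if i = j then 1 else 0)" if "i < m" "j < m" for i j
    using arg_cong[OF orthogonal_realD(3)[OF U], of "\<lambda>X. X $$ (i,j)"] U_carrier that
    by (auto simp: scalar_prod_def lessThan_atLeast0)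
  note moments = isotropic_gaussian_moments[OF \<epsilon> \<sigma>]
  have e_moments: "has_bochner_integral M (e i) 0" "has_bochner_integral M (\<lambda>\<omega>. (e i \<omega>)\<^sup>2) (\<sigma>\<^sup>2)"
    "has_bochner_integral M (\<lambda>\<omega>. (e i \<omega>)^3) 0" "has_bochner_integral M (\<lambda>\<omega>. (e i \<omega>)^4) (3 * \<sigma>^4)"
    if "i < m" for i
  proof -
    have "(\<Sum>k<m. (U $$ (k,i))\<^sup>2) = 1" using orth[OF that that] by (simp only: power2_eq_square simp_thms if_True)
    then show "has_bochner_integral M (e i) 0" "has_bochner_integral M (\<lambda>\<omega>. (e i \<omega>)\<^sup>2) (\<sigma>\<^sup>2)"
      "has_bochner_integral M (\<lambda>\<omega>. (e i \<omega>)^3) 0" "has_bochner_integral M (\<lambda>\<omega>. (e i \<omega>)^4) (3 * \<sigma>^4)"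
      using moments[of "\<lambda>k. U $$ (k,i)"] unfolding e_def[abs_def] by simp_all
  qed
  \<comment> \<open>Any combination of \<open>e i\<close> and \<open>e j\<close> is a linear form in
    \<epsilon> whose coefficient vector has squared norm a^2 + b^2, since the columns of
    \<open>U\<close> are orthonormal.\<close>
  have pair: "standard_moments M (e i) (e j) \<sigma>" if "i < m" "j < m" "i \<noteq> j" for i j
  proof -
    have lin: "a * e i \<omega> + b * e j \<omega> = (\<Sum>k<m. (a * U $$ (k,i) + b * U $$ (k,j)) * vec_index (\<epsilon> \<omega>) k)" for a b \<omega>
      by (simp add: e_def sum_distrib_left sum.distrib algebra_simps)
    have "(\<Sum>k<m. (a * U $$ (k,i) + b * U $$ (k,j))\<^sup>2)
      = a\<^sup>2 * (\<Sum>k<m. U $$ (k,i) * U $$ (k,i)) + 2 * a * b * (\<Sum>k<m. U $$ (k,i) * U $$ (k,j))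
        + b\<^sup>2 * (\<Sum>k<m. U $$ (k,j) * U $$ (k,j))" for a b
      unfolding sum_distrib_left sum.distrib[symmetric]
      by (intro sum.cong refl) (simp add: power2_eq_square algebra_simps)
    then have norm: "(\<Sum>k<m. (a * U $$ (k,i) + b * U $$ (k,j))\<^sup>2) = a\<^sup>2 + b\<^sup>2" for a b
      using orth that by simp
    show ?thesis
    proof
      fix a b
      note mom = moments[of "\<lambda>k. a * U $$ (k,i) + b * U $$ (k,j)", unfolded norm, folded lin]
      show "has_bochner_integral M (\<lambda>\<omega>. a * e i \<omega> + b * e j \<omega>) 0" by (rule mom(1))
      show "has_bochner_integral M (\<lambda>\<omega>. (a * e i \<omega> + b * e j \<omega>)\<^sup>2) (\<sigma>\<^sup>2 * (a\<^sup>2 + b\<^sup>2))" by (rule mom(2))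
      show "has_bochner_integral M (\<lambda>\<omega>. (a * e i \<omega> + b * e j \<omega>)^3) 0" by (rule mom(3))
      show "has_bochner_integral M (\<lambda>\<omega>. (a * e i \<omega> + b * e j \<omega>)^4) (3 * \<sigma>^4 * (a\<^sup>2 + b\<^sup>2)\<^sup>2)" by (rule mom(4))
    qed
  qed
  \<comment> \<open>The variance of the centred variable \<open>\<eta> i\<close>.\<close>
  define v where "v i = (2 * g i * \<xi> i)\<^sup>2 * \<sigma>\<^sup>2 + 2 * \<sigma>^4" for i
  have \<eta>\<eta>: "has_bochner_integral M (\<lambda>\<omega>. \<eta> i \<omega> * \<eta> j \<omega>) (if i = j then v i else 0)" if "i < m" "j < m" for i j
  proof (cases "i = j")
    case True
    then show ?thesis using centered_square_variance[OF e_moments[OF that(1)], of "2 * g i * \<xi> i"]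
      by (simp add: \<eta>_def v_def power2_eq_square)
  next
    case False
    then interpret standard_moments M "e i" "e j" \<sigma> using pair that by simp
    show ?thesis using centered_squares_uncorrelated[of "2 * g i * \<xi> i" "2 * g j * \<xi> j"] False
      by (simp add: \<eta>_def)
  qed
  \<comment> \<open>Squared bias plus variance; the cross term has mean zero.\<close>
  have MSEE: "MSEE M A x y \<alpha> = (\<Sum>i<m. (\<alpha> / D i \<alpha>)\<^sup>2 * (\<xi> i)\<^sup>2 + (g i / D i \<alpha>)\<^sup>2 * \<sigma>\<^sup>2)" if \<alpha>: "\<alpha> \<ge> 0" for \<alpha>
  proof -
    have "MSEE M A x y \<alpha> = (\<integral>\<omega>. (\<Sum>i<m. (\<alpha> / D i \<alpha> * \<xi> i - g i / D i \<alpha> * e i \<omega>)\<^sup>2) \<partial>M)"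
      unfolding MSEE_def y by (intro Bochner_Integration.integral_cong refl)
        (simp add: estimation_error_spectral[OF \<alpha> x \<epsilon>_carrier] e_eq D_def \<xi>_def)
    also have "\<dots> = (\<Sum>i<m. (\<alpha> / D i \<alpha>)\<^sup>2 * (\<xi> i)\<^sup>2 + (g i / D i \<alpha>)\<^sup>2 * \<sigma>\<^sup>2)"
    proof (rule has_bochner_integral_integral_eq)
      show "has_bochner_integral M (\<lambda>\<omega>. \<Sum>i<m. (\<alpha> / D i \<alpha> * \<xi> i - g i / D i \<alpha> * e i \<omega>)\<^sup>2)
        (\<Sum>i<m. (\<alpha> / D i \<alpha>)\<^sup>2 * (\<xi> i)\<^sup>2 + (g i / D i \<alpha>)\<^sup>2 * \<sigma>\<^sup>2)"
    proof (rule has_bochner_integral_sum)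
      fix i assume "i \<in> {..<m}"
      then have "i < m" by simp
      note mul = has_bochner_integral_mult_right
      have "has_bochner_integral M (\<lambda>\<omega>. (p - q * e i \<omega>)\<^sup>2) (p\<^sup>2 + q\<^sup>2 * \<sigma>\<^sup>2)" for p q
        by (rule has_bochner_integral_eqI[OF has_bochner_integral_add[OF has_bochner_integral_prob_const[of "p\<^sup>2"]
            has_bochner_integral_add[OF mul[OF e_moments(1)[OF \<open>i < m\<close>], of "- 2 * p * q"]
              mul[OF e_moments(2)[OF \<open>i < m\<close>], of "q\<^sup>2"]]]])
           (simp_all add: power2_eq_square algebra_simps)
      from this[of "\<alpha> / D i \<alpha> * \<xi> i" "g i / D i \<alpha>"]
      show "has_bochner_integral M (\<lambda>\<omega>. (\<alpha> / D i \<alpha> * \<xi> i - g i / D i \<alpha> * e i \<omega>)\<^sup>2)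
        ((\<alpha> / D i \<alpha>)\<^sup>2 * (\<xi> i)\<^sup>2 + (g i / D i \<alpha>)\<^sup>2 * \<sigma>\<^sup>2)"
        by (simp only: power_mult_distrib)
      qed
    qed
    finally show ?thesis .
  qed
  have SURE: "SURE A \<sigma> \<alpha> (y \<omega>) = (\<Sum>i<m. (1 / g i - g i / D i \<alpha>)\<^sup>2 * (g i * \<xi> i + e i \<omega>)\<^sup>2
       - \<sigma>\<^sup>2 * (1 / (g i)\<^sup>2) + 2 * \<sigma>\<^sup>2 * (1 / D i \<alpha>))" if \<alpha>: "\<alpha> \<ge> 0" and \<omega>: "\<omega> \<in> space M" for \<alpha> \<omega>
  proof -
    have "y \<omega> \<in> carrier_vec m" using A x \<epsilon>_carrier[OF \<omega>] by (simp add: y)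
    moreover have "vec_index (transpose_mat U *\<^sub>v y \<omega>) i = g i * \<xi> i + e i \<omega>" if "i < m" for i
      using observation_spectral[OF x \<epsilon>_carrier[OF \<omega>] that] e_eq[OF \<omega> that] by (simp only: y \<xi>_def)
    ultimately show ?thesis
      by (simp add: SURE_spectral[OF \<alpha>] sum.distrib sum_subtractf sum_distrib_left D_def)
  qed
  have err: "scaled_error M A \<sigma> x y \<omega> \<alpha>
      = \<bar>(\<Sum>i<m. (\<gamma> / g i)\<^sup>2 * (\<alpha> / D i \<alpha>)\<^sup>2 * \<eta> i \<omega>) / real m\<bar>" if \<alpha>: "\<alpha> \<ge> 0" and \<omega>: "\<omega> \<in> space M" for \<alpha> \<omega>
  proof -
    have "SURE A \<sigma> \<alpha> (y \<omega>) - MSEE M A x y \<alpha> = (\<Sum>i<m. (1 / g i)\<^sup>2 * (\<alpha> / D i \<alpha>)\<^sup>2 * \<eta> i \<omega>)"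
      unfolding SURE[OF \<alpha> \<omega>] MSEE[OF \<alpha>] sum_subtractf[symmetric]
    proof (intro sum.cong refl)
      fix i assume "i \<in> {..<m}"
      then have i: "i < m" by simp
      \<comment> \<open>Read \<open>a\<close>, \<open>d\<close>, \<open>t\<close>, \<open>u\<close>
        as g_i, D_i, \<xi>_i, e_i. In terms of b = 1/a and k = (d - a^2)/d = \<alpha>/D_i everything
        is polynomial, and the two sides differ by a multiple of (a b)^2 - 1 = 0.\<close>
      have "(1 / a - a / d)\<^sup>2 * (a * t + u)\<^sup>2 - \<sigma>\<^sup>2 * (1 / a\<^sup>2) + 2 * \<sigma>\<^sup>2 * (1 / d)
          - (((d - a\<^sup>2) / d)\<^sup>2 * t\<^sup>2 + (a / d)\<^sup>2 * \<sigma>\<^sup>2)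
        = (1 / a)\<^sup>2 * ((d - a\<^sup>2) / d)\<^sup>2 * (2 * a * t * u + u\<^sup>2 - \<sigma>\<^sup>2)" if "a \<noteq> 0" "d \<noteq> 0" for a d t u
      proof -
        define b k where "b = 1 / a" and "k = (d - a\<^sup>2) / d"
        have ab: "a * b = 1" using that by (simp add: b_def)
        have eqs: "1 / a - a / d = b * k" "a / d = (1 - k) * b" "1 / d = (1 - k) * b\<^sup>2" "1 / a\<^sup>2 = b\<^sup>2"
          using that by (simp_all add: b_def k_def field_simps power2_eq_square)
        have "(b * k)\<^sup>2 * (a * t + u)\<^sup>2 - \<sigma>\<^sup>2 * b\<^sup>2 + 2 * \<sigma>\<^sup>2 * ((1 - k) * b\<^sup>2) - (k\<^sup>2 * t\<^sup>2 + ((1 - k) * b)\<^sup>2 * \<sigma>\<^sup>2)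
          = b\<^sup>2 * k\<^sup>2 * (2 * a * t * u + u\<^sup>2 - \<sigma>\<^sup>2) + k\<^sup>2 * t\<^sup>2 * ((a * b)\<^sup>2 - 1)"
          by (simp add: power2_eq_square algebra_simps)
        then show ?thesis unfolding eqs(1) unfolding eqs(2-4) b_def[symmetric] k_def[symmetric] ab by simp
      qed
      from this[of "g i" "D i \<alpha>" "\<xi> i" "e i \<omega>"] D[OF i \<alpha>] g_pos[OF i]
      show "(1 / g i - g i / D i \<alpha>)\<^sup>2 * (g i * \<xi> i + e i \<omega>)\<^sup>2 - \<sigma>\<^sup>2 * (1 / (g i)\<^sup>2) + 2 * \<sigma>\<^sup>2 * (1 / D i \<alpha>)
          - ((\<alpha> / D i \<alpha>)\<^sup>2 * (\<xi> i)\<^sup>2 + (g i / D i \<alpha>)\<^sup>2 * \<sigma>\<^sup>2)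
        = (1 / g i)\<^sup>2 * (\<alpha> / D i \<alpha>)\<^sup>2 * \<eta> i \<omega>"
        by (simp add: \<eta>_def D_def)
    qed
    \<comment> \<open>The scaling by the squared condition number turns 1 / g_i^2 into (\<gamma> /
      g_i)^2.\<close>
    moreover have "cond_number A = 1 / \<gamma>" using A sv1 by (simp add: cond_number_def \<gamma>_def)
    moreover have "(\<Sum>i<m. (\<gamma> / g i)\<^sup>2 * (\<alpha> / D i \<alpha>)\<^sup>2 * \<eta> i \<omega>)
        = \<gamma>\<^sup>2 * (\<Sum>i<m. (1 / g i)\<^sup>2 * (\<alpha> / D i \<alpha>)\<^sup>2 * \<eta> i \<omega>)"
      unfolding sum_distrib_left by (intro sum.cong refl) (simp add: power_divide)
    ultimately show ?thesis using A by (simp add: scaled_error_def power_divide)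
  qed
  have \<gamma>: "\<gamma> > 0" using svm by (simp add: \<gamma>_def)
  obtain K where K: "\<And>i. i < m \<Longrightarrow> K i i \<le> 1"
    "\<And>\<eta> \<alpha>. \<alpha> \<ge> 0 \<Longrightarrow> (\<Sum>i<m. (\<gamma> / g i)\<^sup>2 * (\<alpha> / D i \<alpha>)\<^sup>2 * \<eta> i)\<^sup>2 \<le> (\<Sum>i<m. \<Sum>j<m. K i j * (\<eta> i * \<eta> j))"
    using tikhonov_weights_majorant[OF \<gamma>, of m g] g(1) unfolding D_def \<gamma>_def by blast
  define R where "R \<omega> = (\<Sum>i<m. \<Sum>j<m. K i j * (\<eta> i \<omega> * \<eta> j \<omega>)) / (real m)\<^sup>2" for \<omega>
  have R: "has_bochner_integral M R ((\<Sum>i<m. \<Sum>j<m. K i j * (if i = j then v i else 0)) / (real m)\<^sup>2)"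
    unfolding R_def
    by (intro has_bochner_integral_divide has_bochner_integral_sum has_bochner_integral_mult_right \<eta>\<eta>) auto
  \<comment> \<open>The \<open>\<eta> i\<close> being uncorrelated, only the diagonal of
    \<open>K\<close> survives in the mean.\<close>
  have "(\<Sum>i<m. \<Sum>j<m. K i j * (if i = j then v i else 0)) = (\<Sum>i<m. K i i * v i)"
    by (simp add: if_distrib[of "\<lambda>t. _ * t"] cong: if_cong)
  also have "\<dots> \<le> (\<Sum>i<m. 4 * \<sigma>\<^sup>2 * (\<xi> i)\<^sup>2 + 2 * \<sigma>^4)"
  proof (rule sum_mono)
    fix i assume "i \<in> {..<m}"
    then have i: "i < m" by simp
    have "K i i * v i \<le> 1 * v i" using K(1)[OF i] by (intro mult_right_mono) (auto simp: v_def)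
    \<comment> \<open>Singular values at most 1 give (2 g_i \<xi>_i)^2 \<le> 4 \<xi>_i^2.\<close>
    also have "(g i)\<^sup>2 * (4 * \<sigma>\<^sup>2 * (\<xi> i)\<^sup>2) \<le> 1 * (4 * \<sigma>\<^sup>2 * (\<xi> i)\<^sup>2)"
      using g(2)[OF i] g_pos[OF i] by (intro mult_right_mono power_le_one) auto
    then have "1 * v i \<le> 4 * \<sigma>\<^sup>2 * (\<xi> i)\<^sup>2 + 2 * \<sigma>^4" by (simp add: v_def power_mult_distrib mult_ac)
    finally show "K i i * v i \<le> 4 * \<sigma>\<^sup>2 * (\<xi> i)\<^sup>2 + 2 * \<sigma>^4" .
  qed
  also have "\<dots> = 4 * \<sigma>\<^sup>2 * (\<Sum>i<m. (\<xi> i)\<^sup>2) + 2 * real m * \<sigma>^4"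
    by (simp add: sum.distrib sum_distrib_left)
  also have "(\<Sum>i<m. (\<xi> i)\<^sup>2) = sq_norm2 (transpose_mat V *\<^sub>v x)"
    unfolding \<xi>_def using V_carrier x by (intro sq_norm2_sum[symmetric]) auto
  \<comment> \<open>V^T is orthogonal too, \<open>V\<close> being square.\<close>
  also have "\<dots> = sq_norm2 x"
    by (rule sq_norm2_orthogonal[OF _ x]) (use orthogonal_realD[OF V] in \<open>simp add: orthogonal_real_def\<close>)
  finally have "(\<integral>\<omega>. R \<omega> \<partial>M) \<le> (4 * \<sigma>\<^sup>2 * sq_norm2 x + 2 * real m * \<sigma>^4) / (real m)\<^sup>2"
    unfolding has_bochner_integral_integral_eq[OF R] by (rule divide_right_mono) simp
  moreover have "(scaled_error M A \<sigma> x y \<omega> \<alpha>)\<^sup>2 \<le> R \<omega>" if "\<omega> \<in> space M" "\<alpha> \<ge> 0" for \<omega> \<alpha>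
    unfolding err[OF that(2,1)] R_def power2_abs power_divide[of _ "real m"]
    by (intro divide_right_mono K(2)[OF that(2)] zero_le_power2)
  ultimately show "\<exists>R. integrable M R \<and> (\<integral>\<omega>. R \<omega> \<partial>M) \<le> (4 * \<sigma>\<^sup>2 * sq_norm2 x + 2 * real m * \<sigma>^4) / (real m)\<^sup>2 \<and>
     (\<forall>\<omega>\<in>space M. \<forall>\<alpha>\<ge>0. (scaled_error M A \<sigma> x y \<omega> \<alpha>)\<^sup>2 \<le> R \<omega>)"
    using R by (intro exI[of _ R]) (auto simp: has_bochner_integral_iff)
  have [measurable]: "e i \<in> borel_measurable M" if "i < m" for i
    using e_moments(1)[OF that] by (simp add: has_bochner_integral_iff borel_measurable_integrable)
  show "(\<lambda>\<omega>. scaled_error M A \<sigma> x y \<omega> \<alpha>) \<in> borel_measurable M" if "\<alpha> \<ge> 0" for \<alpha>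
  proof (subst measurable_cong[OF err[OF that]])
    show "(\<lambda>\<omega>. \<bar>(\<Sum>i<m. (\<gamma> / g i)\<^sup>2 * (\<alpha> / D i \<alpha>)\<^sup>2 * \<eta> i \<omega>) / real m\<bar>) \<in> borel_measurable M"
      unfolding \<eta>_def by measurable
  qed
  show "continuous_on {0..} (scaled_error M A \<sigma> x y \<omega>)" if "\<omega> \<in> space M" for \<omega>
  proof (subst continuous_on_cong[OF refl err[OF _ that]])
    have "continuous_on {0..} (D i)" for i unfolding D_def by (intro continuous_intros)
    then show "continuous_on {0..} (\<lambda>\<alpha>. \<bar>(\<Sum>i<m. (\<gamma> / g i)\<^sup>2 * (\<alpha> / D i \<alpha>)\<^sup>2 * \<eta> i \<omega>) / real m\<bar>)"
      using m D by (intro continuous_intros) (auto simp: less_imp_neq[symmetric])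
  qed auto
qed

text \<open>The majorant \<open>R\<close> bounds the error uniformly in \<alpha>. Hence
  \<open>SUP\<close> is a true supremum, and its square is dominated by the integrable
  \<open>R\<close>.\<close>

lemma sup_error_second_moment:
  fixes M :: "'w measure" and A :: "real mat"
  assumes M: "prob_space M" and \<sigma>: "\<sigma> > 0" and m: "m \<ge> 1" and A: "A \<in> carrier_mat m m"
    and x: "x \<in> carrier_vec m" and \<epsilon>: "isotropic_gaussian M m \<sigma> \<epsilon>"
    and y: "\<And>\<omega>. y \<omega> = A *\<^sub>v x + \<epsilon> \<omega>"
    and sv1: "singular_value A 1 = 1" and svm: "singular_value A m > 0"
  shows "\<And>\<omega>. \<omega> \<in> space M \<Longrightarrow> bdd_above (scaled_error M A \<sigma> x y \<omega> ` {0..})"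
    and "sup_error M A \<sigma> x y \<in> borel_measurable M"
    and "integrable M (\<lambda>\<omega>. (sup_error M A \<sigma> x y \<omega>)\<^sup>2)"
    and "(\<integral>\<omega>. (sup_error M A \<sigma> x y \<omega>)\<^sup>2 \<partial>M) \<le> (4 * \<sigma>\<^sup>2 * sq_norm2 x + 2 * real m * \<sigma>^4) / (real m)\<^sup>2"
proof -
  note major = scaled_error_majorant[OF assms]
  obtain R where R: "integrable M R"
      "(\<integral>\<omega>. R \<omega> \<partial>M) \<le> (4 * \<sigma>\<^sup>2 * sq_norm2 x + 2 * real m * \<sigma>^4) / (real m)\<^sup>2"
    and le: "\<And>\<omega> \<alpha>. \<omega> \<in> space M \<Longrightarrow> \<alpha> \<ge> 0 \<Longrightarrow> (scaled_error M A \<sigma> x y \<omega> \<alpha>)\<^sup>2 \<le> R \<omega>"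
    using major(1) by blast
  have le': "scaled_error M A \<sigma> x y \<omega> \<alpha> \<le> sqrt (R \<omega>)" if "\<omega> \<in> space M" "\<alpha> \<ge> 0" for \<omega> \<alpha>
    using le[OF that] by (rule real_le_rsqrt)
  show bdd: "bdd_above (scaled_error M A \<sigma> x y \<omega> ` {0..})" if "\<omega> \<in> space M" for \<omega>
    using le'[OF that] by (intro bdd_aboveI2[of _ _ "sqrt (R \<omega>)"]) auto
  have "sup_error M A \<sigma> x y \<omega> = (SUP \<alpha>\<in>{0..} \<inter> \<rat>. scaled_error M A \<sigma> x y \<omega> \<alpha>)" if "\<omega> \<in> space M" for \<omega>
    unfolding sup_error_def by (rule SUP_real_eq_SUP_Rats[OF major(3)[OF that] bdd[OF that]])
  moreover have "(\<lambda>\<omega>. SUP \<alpha>\<in>{0..} \<inter> \<rat>. scaled_error M A \<sigma> x y \<omega> \<alpha>) \<in> borel_measurable M"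
    by (rule borel_measurable_cSUP) (auto intro: countable_rat major(2) bdd_above_mono[OF bdd])
  ultimately show meas: "sup_error M A \<sigma> x y \<in> borel_measurable M"
    by (subst measurable_cong) auto
  have sup_le: "(sup_error M A \<sigma> x y \<omega>)\<^sup>2 \<le> R \<omega>" if \<omega>: "\<omega> \<in> space M" for \<omega>
  proof -
    \<comment> \<open>Squaring the bound on the supremum requires nonnegativity, which follows from
      the value at \<alpha> = 0, a modulus.\<close>
    have "0 \<le> scaled_error M A \<sigma> x y \<omega> 0" by (simp add: scaled_error_def)
    also have "\<dots> \<le> sup_error M A \<sigma> x y \<omega>"
      unfolding sup_error_def by (rule cSUP_upper[OF _ bdd[OF \<omega>]]) simp
    finally have nonneg: "0 \<le> sup_error M A \<sigma> x y \<omega>" .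
    have "sup_error M A \<sigma> x y \<omega> \<le> sqrt (R \<omega>)"
      unfolding sup_error_def by (rule cSUP_least) (use le'[OF \<omega>] in auto)
    then have "(sup_error M A \<sigma> x y \<omega>)\<^sup>2 \<le> (sqrt (R \<omega>))\<^sup>2" using nonneg by (rule power_mono)
    moreover have "R \<omega> \<ge> 0" using le[OF \<omega>, of 0] by (meson order_trans zero_le_power2 order_refl)
    ultimately show ?thesis by simp
  qed
  show int: "integrable M (\<lambda>\<omega>. (sup_error M A \<sigma> x y \<omega>)\<^sup>2)"
  proof (rule Bochner_Integration.integrable_bound[OF R(1)])
    show "(\<lambda>\<omega>. (sup_error M A \<sigma> x y \<omega>)\<^sup>2) \<in> borel_measurable M" using meas by measurable
    show "AE \<omega> in M. norm ((sup_error M A \<sigma> x y \<omega>)\<^sup>2) \<le> norm (R \<omega>)"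
      by (rule AE_I2) (auto intro: order_trans[OF sup_le abs_ge_self])
  qed
  have "(\<integral>\<omega>. (sup_error M A \<sigma> x y \<omega>)\<^sup>2 \<partial>M) \<le> (\<integral>\<omega>. R \<omega> \<partial>M)"
    by (rule integral_mono[OF int R(1) sup_le])
  then show "(\<integral>\<omega>. (sup_error M A \<sigma> x y \<omega>)\<^sup>2 \<partial>M) \<le> (4 * \<sigma>\<^sup>2 * sq_norm2 x + 2 * real m * \<sigma>^4) / (real m)\<^sup>2"
    using R(2) by simp
qed

text \<open>Markov's inequality for Z^2 bounds the tail probability at T r by C / T^2 for all large
  m, and this tends to 0 as T grows. Positivity of \<open>r\<close> is asked from m = 1 on, since
  \<open>1 / sqrt (real m)\<close> is 0 at m = 0.\<close>

lemma big_O_prob_of_second_moment: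
  fixes Z :: "nat \<Rightarrow> 'w \<Rightarrow> real"
  assumes prob: "\<And>m. prob_space (M m)"
    and meas: "\<And>m. Z m \<in> borel_measurable (M m)"
    and int: "\<And>m. m \<ge> 1 \<Longrightarrow> integrable (M m) (\<lambda>\<omega>. (Z m \<omega>)\<^sup>2)"
    and bound: "eventually (\<lambda>m. (\<integral>\<omega>. (Z m \<omega>)\<^sup>2 \<partial>M m) \<le> C * (r m)\<^sup>2) sequentially"
    and r: "\<And>m. m \<ge> 1 \<Longrightarrow> r m > 0"
  shows "big_O_prob M Z r"
  unfolding big_O_prob_def
proof (intro conjI allI meas)
  let ?p = "\<lambda>T m. measure (M m) {\<omega> \<in> space (M m). \<bar>Z m \<omega>\<bar> > T * r m}"
  have lower: "0 \<le> limsup (\<lambda>m. ereal (?p T m))" for T by (rule le_Limsup) auto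
  have upper: "limsup (\<lambda>m. ereal (?p T m)) \<le> ereal (C / T\<^sup>2)" if T: "T > 0" for T
  proof (rule Limsup_bounded)
    show "\<forall>\<^sub>F m in sequentially. ereal (?p T m) \<le> ereal (C / T\<^sup>2)"
      using bound eventually_ge_at_top[of 1]
    proof eventually_elim
      case (elim m)
      have pos: "0 < T * r m" using T r[OF elim(2)] by simp
      note [measurable] = meas[of m]
      have "{\<omega> \<in> space (M m). \<bar>Z m \<omega>\<bar> > T * r m} \<subseteq> {\<omega> \<in> space (M m). (Z m \<omega>)\<^sup>2 \<ge> (T * r m)\<^sup>2}"
        using pos by (auto simp: abs_le_square_iff[symmetric])
      then have "?p T m \<le> measure (M m) {\<omega> \<in> space (M m). (Z m \<omega>)\<^sup>2 \<ge> (T * r m)\<^sup>2}"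
        by (rule finite_measure.finite_measure_mono[OF prob_space.finite_measure[OF prob]]) measurable
      also have "\<dots> \<le> (\<integral>\<omega>. (Z m \<omega>)\<^sup>2 \<partial>M m) / (T * r m)\<^sup>2"
        using int[OF elim(2)] pos by (intro integral_Markov_inequality_measure[where A = "{}"]) auto
      also have "\<dots> \<le> C * (r m)\<^sup>2 / (T * r m)\<^sup>2" by (intro divide_right_mono elim) simp
      also have "\<dots> = C / T\<^sup>2" using r[OF elim(2)] by (simp add: power_mult_distrib)
      finally show ?case by simp
    qed
  qed
  have "((\<lambda>T. C / T\<^sup>2) \<longlongrightarrow> 0) at_top"
    by (intro tendsto_divide_0[OF tendsto_const] filterlim_at_top_imp_at_infinity filterlim_pow_at_top filterlim_ident) simp
  then have lim: "((\<lambda>T. ereal (C / T\<^sup>2)) \<longlongrightarrow> 0) at_top" by (simp add: zero_ereal_def)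
  \<comment> \<open>The upper bound holds for T > 0 only, which is eventually the case.\<close>
  show "((\<lambda>T. limsup (\<lambda>m. ereal (?p T m))) \<longlongrightarrow> 0) at_top"
    by (rule tendsto_sandwich[OF always_eventually _ tendsto_const lim])
      (auto intro: lower eventually_mono[OF eventually_gt_at_top[of 0]] upper)
qed

text \<open>Boundedness and integrability belong to the conclusion because a real \<open>SUP\<close>
  of an unbounded set and the integral of a nonintegrable function are mere default values; with
  them the two estimates concern the actual supremum and expectation.\<close>

theorem theorem6:
  fixes M :: "nat \<Rightarrow> 'w measure"
    and A :: "nat \<Rightarrow> real mat"
    and x :: "nat \<Rightarrow> real Matrix.vec"
    and \<epsilon> y :: "nat \<Rightarrow> 'w \<Rightarrow> real Matrix.vec"
    and \<sigma> :: real
  assumes "\<And>m. prob_space (M m)"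
    and "\<sigma> > 0"
    and "\<And>m. A m \<in> carrier_mat m m"
    and "\<And>m. vec_space.rank m (A m) = m"
    and "\<And>m. x m \<in> carrier_vec m"
    and "\<And>m. isotropic_gaussian (M m) m \<sigma> (\<epsilon> m)"
    and "\<And>m \<omega>. y m \<omega> = A m *\<^sub>v x m + \<epsilon> m \<omega>"
    and "\<And>m. m \<ge> 1 \<Longrightarrow> singular_value (A m) 1 = 1"
    and "\<And>m i. 1 \<le> i \<Longrightarrow> i < m \<Longrightarrow> singular_value (A m) i \<ge> singular_value (A m) (i + 1)"
    and "\<And>m. m \<ge> 1 \<Longrightarrow> singular_value (A m) m > 0"
    and "(\<lambda>m. singular_value (A m) m) \<longlonglongrightarrow> 0"
    and "(\<lambda>m. sq_norm2 (x m)) \<in> O(\<lambda>m. real m)"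
  shows "(\<forall>m\<ge>1. \<forall>\<omega>\<in>space (M m).
            bdd_above (scaled_error (M m) (A m) \<sigma> (x m) (y m) \<omega> ` {0..})) \<and>
         big_O_prob M (\<lambda>m. sup_error (M m) (A m) \<sigma> (x m) (y m)) (\<lambda>m. 1 / sqrt (real m)) \<and>
         (\<forall>m\<ge>1. integrable (M m) (\<lambda>\<omega>. (sup_error (M m) (A m) \<sigma> (x m) (y m) \<omega>)\<^sup>2)) \<and>
         (\<lambda>m. \<integral>\<omega>. (sup_error (M m) (A m) \<sigma> (x m) (y m) \<omega>)\<^sup>2 \<partial>M m) \<in> O(\<lambda>m. 1 / real m)"
proof -
  note moment = sup_error_second_moment[OF assms(1,2) _ assms(3,5,6,7,8,10)]
  obtain c where c: "eventually (\<lambda>m. norm (sq_norm2 (x m)) \<le> c * norm (real m)) sequentially"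
    using assms(12) by (auto elim: landau_o.bigE)
  \<comment> \<open>Chosen so that the bound \<open>c * real m\<close> on the squared norm makes the
    numerator of the moment bound at most \<open>C * real m\<close>.\<close>
  define C where "C = 4 * \<sigma>\<^sup>2 * c + 2 * \<sigma>^4"
  let ?Z = "\<lambda>m. sup_error (M m) (A m) \<sigma> (x m) (y m)"
  have bound: "eventually (\<lambda>m. (\<integral>\<omega>. (?Z m \<omega>)\<^sup>2 \<partial>M m) \<le> C / real m) sequentially"
    using c eventually_ge_at_top[of 1]
  proof eventually_elim
    case (elim m)
    have "4 * \<sigma>\<^sup>2 * sq_norm2 (x m) \<le> 4 * \<sigma>\<^sup>2 * (c * real m)" using elim by (intro mult_left_mono) auto
    then have "(4 * \<sigma>\<^sup>2 * sq_norm2 (x m) + 2 * real m * \<sigma>^4) / (real m)\<^sup>2 \<le> C * real m / (real m)\<^sup>2"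
      by (intro divide_right_mono) (auto simp: C_def algebra_simps)
    also have "\<dots> = C / real m" by (simp add: power2_eq_square)
    finally show ?case using moment(4)[of m] elim by simp
  qed
  \<comment> \<open>\<open>big_O_prob\<close> asks for measurability at m = 0 as well; there
    division by zero gives 0 and the error vanishes.\<close>
  have "?Z m \<in> borel_measurable (M m)" for m
  proof (cases "m = 0")
    case True
    then have "scaled_error (M m) (A m) \<sigma> (x m) (y m) \<omega> \<alpha> = 0" for \<omega> \<alpha>
      using assms(3)[of m] by (auto simp: scaled_error_def)
    then have "?Z m = (\<lambda>_. 0)" by (simp add: sup_error_def[abs_def])
    then show ?thesis by simp
  next
    case False
    then show ?thesis by (intro moment(2)) auto
  qed
  then have "big_O_prob M ?Z (\<lambda>m. 1 / sqrt (real m))"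
    using bound by (intro big_O_prob_of_second_moment[where C = C] assms(1) moment(3)) (auto simp: power_divide)
  \<comment> \<open>The witness |C| + 1 is positive whatever the sign of \<open>C\<close>.\<close>
  moreover have "(\<lambda>m. \<integral>\<omega>. (?Z m \<omega>)\<^sup>2 \<partial>M m) \<in> O(\<lambda>m. 1 / real m)"
    by (rule landau_o.bigI[of "\<bar>C\<bar> + 1"])
      (auto intro!: eventually_mono[OF bound] order_trans[OF _ divide_right_mono[of C "\<bar>C\<bar> + 1"]])
  ultimately show ?thesis using moment(1,3) by auto
qed

end
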